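(* Let $X$ be a Polish metric space. The following assertions are equivalent: (a) $X$ is compact. (b) If $X_1,X_2\subseteq\mathbb U$ are both isometric to $X$ and $\varphi\colon X_1\to X_2$ is an isometry, then there exists $\tilde\varphi\in \mathrm{Iso}(\mathbb U)$ which extends $\varphi$. (c) If $X_1,X_2\subseteq\mathbb U$ are both isometric to $X$, then there exists $\varphi\in\mathrm{Iso}(\mathbb U)$ such that $\varphi(X_1)=X_2$. (d) If $X_1\subseteq\mathbb U$ is isometric to $X$ and $f\in E(X_1)$, then there exists $z\in\mathbb U$ such that $d(z,x)=f(x)$ for all $x\in X_1$.
   Context: A Polish metric space is a complete separable metric space. $\mathbb U$ (with distance $d$) denotes the Urysohn space: the unique (up to isometry) nonempty complete separable metric space that is finitely injective, i.e. for any finite metric spaces $K\subseteq L$ and any isometric embedding $\varphi\colon K\to\mathbb U$ there is an isometric embedding $\tilde\varphi\colon L\to\mathbb U$ extending $\varphi$. An isometry is a distance-preserving map that is onto; $\mathrm{Iso}(\mathbb U)$ is the group of isometries of $\mathbb U$ onto itself. For a metric space $(Y,d)$, $E(Y)$ is the set of Katětov maps on $Y$, i.e. maps $f\colon Y\to\mathbb R$ with $|f(x)-f(y)|\le d(x,y)\le f(x)+f(y)$ for all $x,y\in Y$. *)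

theory Defs
  imports "HOL-Analysis.Analysis"
begin

definition isometry :: "('a::metric_space \<Rightarrow> 'b::metric_space) \<Rightarrow> 'a set \<Rightarrow> 'b set \<Rightarrow> bool" where
  "isometry f A B \<longleftrightarrow> f ` A = B \<and> (\<forall>x\<in>A. \<forall>y\<in>A. dist (f x) (f y) = dist x y)"

definition isometric :: "'a::metric_space set \<Rightarrow> 'b::metric_space set \<Rightarrow> bool" where
  "isometric A B \<longleftrightarrow> (\<exists>f. isometry f A B)"

definition Iso :: "'u::metric_space set \<Rightarrow> ('u \<Rightarrow> 'u) set" where
  "Iso U = {f. isometry f U U}"

text \<open>Only the values on \<open>Y\<close> of a function in \<open>Katetov_maps Y\<close> matter; off \<open>Y\<close> it is arbitrary.\<close>

definition Katetov_maps :: "'a::metric_space set \<Rightarrow> ('a \<Rightarrow> real) set" where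
  "Katetov_maps Y =
     {f. \<forall>x\<in>Y. \<forall>y\<in>Y. \<bar>f x - f y\<bar> \<le> dist x y \<and> dist x y \<le> f x + f y}"

definition isometric_embedding ::
    "'b set \<Rightarrow> ('b \<Rightarrow> 'b \<Rightarrow> real) \<Rightarrow> 'u::metric_space set \<Rightarrow> ('b \<Rightarrow> 'u) \<Rightarrow> bool" where
  "isometric_embedding K \<delta> U \<phi> \<longleftrightarrow>
     \<phi> ` K \<subseteq> U \<and> (\<forall>x\<in>K. \<forall>y\<in>K. dist (\<phi> x) (\<phi> y) = \<delta> x y)"

text \<open>One cannot quantify over types inside a definition, so the finite metric spaces are
  taken with points in \<^typ>\<open>nat\<close>. No generality is lost: the lemma
  \<open>finitely_injective_extend\<close> below recovers the property for finite metric spaces over an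
  arbitrary type.\<close>

definition finitely_injective :: "'u::metric_space set \<Rightarrow> bool" where
  "finitely_injective U \<longleftrightarrow>
     (\<forall>(L :: nat set) \<delta> K \<phi>.
        finite L \<and> Metric_space L \<delta> \<and> K \<subseteq> L \<and> isometric_embedding K \<delta> U \<phi> \<longrightarrow>
        (\<exists>\<psi>. isometric_embedding L \<delta> U \<psi> \<and> (\<forall>x\<in>K. \<psi> x = \<phi> x)))"

lemma finitely_injective_extend:
  fixes U :: "'u::metric_space set" and L :: "'b set"
  assumes U: "finitely_injective U"
    and L: "finite L" "Metric_space L \<delta>" "K \<subseteq> L"
    and \<phi>: "isometric_embedding K \<delta> U \<phi>"
  shows "\<exists>\<psi>. isometric_embedding L \<delta> U \<psi> \<and> (\<forall>x\<in>K. \<psi> x = \<phi> x)"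
proof -
  obtain e :: "'b \<Rightarrow> nat" where e: "inj_on e L"
    using finite_imp_inj_to_nat_seg[OF L(1)] by blast
  define g where "g = inv_into L e"
  have g: "g (e x) = x" if "x \<in> L" for x
    using e that by (simp add: g_def)
  interpret Metric_space L \<delta> by fact
  have "Metric_space (e ` L) (\<lambda>m n. \<delta> (g m) (g n))"
  proof
    show "\<delta> (g x) (g y) = 0 \<longleftrightarrow> x = y" if "x \<in> e ` L" "y \<in> e ` L" for x y
      using that by (auto simp: g)
    show "\<delta> (g x) (g z) \<le> \<delta> (g x) (g y) + \<delta> (g y) (g z)"
      if "x \<in> e ` L" "y \<in> e ` L" "z \<in> e ` L" for x y z
      using that by (auto simp: g triangle)
  qed (auto simp: commute)
  moreover have "isometric_embedding (e ` K) (\<lambda>m n. \<delta> (g m) (g n)) U (\<phi> \<circ> g)"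
    using \<phi> L(3) unfolding isometric_embedding_def by (auto simp: g subset_iff)
  moreover have "finite (e ` L)" "e ` K \<subseteq> e ` L"
    using L by auto
  ultimately obtain \<psi>
    where \<psi>: "isometric_embedding (e ` L) (\<lambda>m n. \<delta> (g m) (g n)) U \<psi>"
      and ext: "\<forall>n\<in>e ` K. \<psi> n = (\<phi> \<circ> g) n"
    using U unfolding finitely_injective_def by blast
  have "isometric_embedding L \<delta> U (\<psi> \<circ> e)"
    using \<psi> unfolding isometric_embedding_def by (auto simp: g)
  moreover have "\<forall>x\<in>K. (\<psi> \<circ> e) x = \<phi> x"
    using ext L(3) by (auto simp: g subset_iff)
  ultimately show ?thesis by blast
qed

text \<open>The Urysohn space is determined only up to isometry, so it is described by its defining
  properties. The whole type carries the space; \<^class>\<open>polish_space\<close> supplies a complete,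
  second countable (equivalently, separable) metric, and types are nonempty.\<close>

definition is_Urysohn :: "'u::polish_space itself \<Rightarrow> bool" where
  "is_Urysohn _ \<longleftrightarrow> finitely_injective (UNIV :: 'u set)"

text \<open>A Polish metric space is a set rather than a type here, so that it may be empty.\<close>

definition Polish_metric :: "'a::metric_space set \<Rightarrow> bool" where
  "Polish_metric X \<longleftrightarrow> complete X \<and> separable_space (top_of_set X)"

end

theory Submission
  imports Defs "HOL-Complex_Analysis.Great_Picard" "HOL-Library.Ramsey"
begin

text \<open>For compact \<open>X\<close>, a Katetov map on a copy of \<open>X\<close> is realized by the limit of points that
  realize it on finer and finer finite nets; a back-and-forth argument with compact partial
  isometries then yields the extension property.

  For noncompact \<open>X\<close>, one finds a Katetov map \<open>f\<close> on \<open>X\<close> and a copy of \<open>X\<close> in the Urysohn space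
  over which no \<open>f \<circ> \<sigma>\<close>, with \<open>\<sigma>\<close> an isometry of \<open>X\<close>, is realized. Over another copy \<open>f\<close> is
  realized, so no isometry of the whole space exchanges the two copies. By Ramsey's theorem, an
  infinite separated sequence \<open>s\<close> in \<open>X\<close> may be taken to be of one of two kinds, relative to a base
  point \<open>x\<^sub>0\<close>. Either the inequality \<open>\<bar>d(x\<^sub>0,s\<^sub>m) - d(x\<^sub>0,s\<^sub>n)\<bar> \<le> d(s\<^sub>m,s\<^sub>n)\<close> has a uniform defect;
  then \<open>d(x\<^sub>0,s\<^sub>n)\<close> can be perturbed to an oscillating \<open>f\<close>, while there is a copy of \<open>X\<close> over which only
  uniform limits of finitely supported Katetov maps are realized. Or the defect is uniformly bounded
  and \<open>s\<close> tends to infinity almost along a geodesic ray; then there is a copy of \<open>X\<close> such that all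
  points of the Urysohn space approach infinity along \<open>s\<close> through points of the copy, which rules
  out \<open>f = d(x\<^sub>0,\<cdot>) + 1\<close>.\<close>

section \<open>Katetov maps and isometries\<close>

lemma Katetov_mapsD:
  assumes "f \<in> Katetov_maps X" "x \<in> X" "y \<in> X"
  shows "f x \<le> f y + dist x y" "dist x y \<le> f x + f y" "0 \<le> f x"
proof -
  have *: "\<bar>f a - f b\<bar> \<le> dist a b" "dist a b \<le> f a + f b" if "a \<in> X" "b \<in> X" for a b
    using assms(1) that by (auto simp: Katetov_maps_def)
  show "f x \<le> f y + dist x y" "dist x y \<le> f x + f y" "0 \<le> f x"
    using *[OF assms(2,3)] *[OF assms(2,2)] by auto
qed

lemma Katetov_mapsI:
  assumes "\<And>x y. x \<in> X \<Longrightarrow> y \<in> X \<Longrightarrow> f x \<le> f y + dist x y"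
    and "\<And>x y. x \<in> X \<Longrightarrow> y \<in> X \<Longrightarrow> dist x y \<le> f x + f y"
  shows "f \<in> Katetov_maps X"
  unfolding Katetov_maps_def
proof (clarify, intro conjI)
  fix x y assume "x \<in> X" "y \<in> X"
  then show "\<bar>f x - f y\<bar> \<le> dist x y" "dist x y \<le> f x + f y"
    using assms(1)[of x y] assms(1)[of y x] assms(2) by (auto simp: dist_commute)
qed

lemma Katetov_maps_mono: "Y \<subseteq> X \<Longrightarrow> Katetov_maps X \<subseteq> Katetov_maps Y"
  unfolding Katetov_maps_def by blast

lemma dist_in_Katetov_maps: "dist a \<in> Katetov_maps X"
proof (rule Katetov_mapsI)
  fix x y
  show "dist a x \<le> dist a y + dist x y" by (rule dist_triangle2)
  show "dist x y \<le> dist a x + dist a y" by (rule dist_triangle3)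
qed

lemma isometry_inj_on:
  assumes "isometry f A B"
  shows "inj_on f A"
proof (rule inj_onI)
  fix x y assume xy: "x \<in> A" "y \<in> A" and eq: "f x = f y"
  have "dist (f x) (f y) = dist x y" using assms xy unfolding isometry_def by blast
  then show "x = y" by (simp add: eq)
qed

lemma isometry_sym:
  assumes "isometry f A B"
  shows "isometry (inv_into A f) B A"
proof -
  have fA: "f ` A = B" and d: "\<And>x y. x \<in> A \<Longrightarrow> y \<in> A \<Longrightarrow> dist (f x) (f y) = dist x y"
    using assms by (auto simp: isometry_def)
  have "inv_into A f ` B = A"
    using fA isometry_inj_on[OF assms] by force
  moreover have "dist (inv_into A f x) (inv_into A f y) = dist x y" if "x \<in> B" "y \<in> B" for x y
    using d[of "inv_into A f x" "inv_into A f y"] that fA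
    by (simp add: f_inv_into_f inv_into_into)
  ultimately show ?thesis by (simp add: isometry_def)
qed

lemma isometry_trans:
  "isometry f A B \<Longrightarrow> isometry g B C \<Longrightarrow> isometry (g \<circ> f) A C"
  unfolding isometry_def by (force simp: image_comp[symmetric])

lemma isometry_imp_compact:
  assumes "isometry f A B" "compact A"
  shows "compact B"
proof -
  have "continuous_on A f"
    using assms(1) unfolding isometry_def continuous_on_iff by metis
  then show ?thesis
    using assms compact_continuous_image unfolding isometry_def by blast
qed

text \<open>Completeness of the target extends the uniformly continuous \<open>g\<close> to the
  closure; the difference of the two distances is continuous and vanishes on
  \<open>A \<times> A\<close>, hence on its closure.\<close>

lemma isometric_extension_on_closure:
  fixes g :: "'a::metric_space \<Rightarrow> 'b::complete_space"
  assumes g: "\<And>x y. x \<in> A \<Longrightarrow> y \<in> A \<Longrightarrow> dist (g x) (g y) = dist x y"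
  obtains h where "\<And>x. x \<in> A \<Longrightarrow> h x = g x"
    "\<And>x y. x \<in> closure A \<Longrightarrow> y \<in> closure A \<Longrightarrow> dist (h x) (h y) = dist x y"
proof -
  have "uniformly_continuous_on A g"
    unfolding uniformly_continuous_on_def using g by metis
  then obtain h where h: "uniformly_continuous_on (closure A) h" "\<And>x. x \<in> A \<Longrightarrow> g x = h x"
    using uniformly_continuous_on_extension_on_closure by metis
  have hc: "continuous_on (closure A) h"
    using h(1) by (rule uniformly_continuous_imp_continuous)
  have "continuous_on (closure (A \<times> A)) (\<lambda>p. dist (h (fst p)) (h (snd p)) - dist (fst p) (snd p))"
    unfolding closure_Times
    by (intro continuous_intros continuous_on_compose2[OF hc]) auto
  note const = continuous_constant_on_closure[OF this, of 0]
  have "dist (h x) (h y) = dist x y" if "x \<in> closure A" "y \<in> closure A" for x y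
    using const[of "(x, y)"] that h(2) g by (auto simp: closure_Times)
  then show ?thesis using that h(2) by metis
qed

section \<open>Realizing Katetov maps on compact sets\<close>

text \<open>A Katetov map is a one-point metric extension: \<open>None\<close> is adjoined to a copy
  of \<open>F\<close> at the distances \<open>f\<close>. If \<open>f\<close> has a zero, the new
  point would coincide with an old one, so that old point is taken instead.\<close>

lemma realize_finite_Katetov_map:
  fixes F :: "'u::metric_space set"
  assumes U: "finitely_injective (UNIV :: 'u set)"
    and F: "finite F" and f: "f \<in> Katetov_maps F"
  shows "\<exists>z. \<forall>x\<in>F. dist z x = f x"
proof (cases "\<exists>x\<in>F. f x = 0")
  case True
  then obtain z where z: "z \<in> F" "f z = 0" by blast
  have "dist z x = f x" if "x \<in> F" for x
    using Katetov_mapsD[OF f that z(1)] Katetov_mapsD[OF f z(1) that] z(2)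
    by (simp add: dist_commute)
  then show ?thesis by blast
next
  case False
  then have pos: "0 < f x" if "x \<in> F" for x
    using Katetov_mapsD(3)[OF f that that] that by force
  define \<delta> where "\<delta> a b = (case a of None \<Rightarrow> (case b of None \<Rightarrow> 0 | Some y \<Rightarrow> f y)
      | Some x \<Rightarrow> (case b of None \<Rightarrow> f x | Some y \<Rightarrow> dist x y))" for a b
  let ?L = "insert None (Some ` F)"
  have K: "f x \<le> f y + dist x y" "dist x y \<le> f x + f y" if "x \<in> F" "y \<in> F" for x y
    using Katetov_mapsD[OF f that] by auto
  \<comment> \<open>\<open>Metric_space\<close> demands nonnegativity for all arguments, also
    outside the carrier, where \<open>f\<close> may be negative; hence the cut-off to 0.\<close>
  define \<delta>' where "\<delta>' a b = (if a \<in> ?L \<and> b \<in> ?L then \<delta> a b else 0)" for a b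
  have "Metric_space ?L \<delta>'"
  proof
    show "0 \<le> \<delta>' a b" for a b
      using pos by (auto simp: \<delta>'_def \<delta>_def less_imp_le split: option.splits)
    show "\<delta>' a b = \<delta>' b a" for a b
      by (auto simp: \<delta>'_def \<delta>_def dist_commute split: option.splits)
    show "\<delta>' a b = 0 \<longleftrightarrow> a = b" if "a \<in> ?L" "b \<in> ?L" for a b
      using that pos by (fastforce simp: \<delta>'_def \<delta>_def split: option.splits)
    have K': "f y \<le> f x + dist x y" "f x \<le> dist x y + f y" if "x \<in> F" "y \<in> F" for x y
      using K(1)[OF that] K(1)[OF that(2,1)] by (simp_all add: dist_commute)
    show "\<delta>' a c \<le> \<delta>' a b + \<delta>' b c" if "a \<in> ?L" "b \<in> ?L" "c \<in> ?L" for a b c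
      using that
      by (auto simp: \<delta>'_def \<delta>_def less_imp_le[OF pos] K' K(2) dist_triangle)
  qed
  moreover have "isometric_embedding (Some ` F) \<delta>' (UNIV :: 'u set) the"
    by (auto simp: isometric_embedding_def \<delta>'_def \<delta>_def)
  ultimately obtain \<psi> where \<psi>: "isometric_embedding ?L \<delta>' (UNIV :: 'u set) \<psi>"
      "\<forall>x\<in>Some ` F. \<psi> x = the x"
    using finitely_injective_extend[OF U, of ?L \<delta>' "Some ` F" the] F by auto
  have "dist (\<psi> None) x = f x" if "x \<in> F" for x
  proof -
    have "dist (\<psi> None) (\<psi> (Some x)) = \<delta>' None (Some x)"
      using \<psi>(1) that by (auto simp: isometric_embedding_def)
    then show ?thesis using \<psi>(2) that by (simp add: \<delta>'_def \<delta>_def)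
  qed
  then show ?thesis by blast
qed

text \<open>Both \<open>dist z\<close> and \<open>f\<close> are 1-Lipschitz and agree on the net, so
  each contributes at most \<open>e / 2\<close>.\<close>

lemma approximate_on_net:
  assumes f: "f \<in> Katetov_maps K" and F: "F \<subseteq> K" "K \<subseteq> (\<Union>y\<in>F. ball y (e / 2))"
    and z: "\<And>y. y \<in> F \<Longrightarrow> dist z y = f y" and x: "x \<in> K"
  shows "\<bar>dist z x - f x\<bar> \<le> e"
proof -
  obtain y where y: "y \<in> F" "dist y x < e / 2"
    using F x by auto
  have "f x \<le> f y + dist x y" "f y \<le> f x + dist y x"
    using Katetov_mapsD[OF f] x y F by blast+
  moreover have "dist z x \<le> dist z y + dist y x" "dist z y \<le> dist z x + dist y x"
    by (metis dist_triangle, metis dist_commute dist_triangle)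
  ultimately show ?thesis
    using y z[OF y(1)] by (auto simp: dist_commute abs_le_iff)
qed

text \<open>The value of the extended Katetov map at the old approximation \<open>z\<close> is the least one that
  is 1-Lipschitz compatible with \<open>f\<close> on the net; this is what keeps the new point close to \<open>z\<close>.\<close>

lemma improve_approximation:
  fixes K :: "'u::metric_space set"
  assumes U: "finitely_injective (UNIV :: 'u set)"
    and K: "compact K" and f: "f \<in> Katetov_maps K"
    and z: "\<And>x. x \<in> K \<Longrightarrow> \<bar>dist z x - f x\<bar> \<le> e" and e: "0 \<le> e" and e': "0 < e'"
  shows "\<exists>z'. dist z z' \<le> e \<and> (\<forall>x\<in>K. \<bar>dist z' x - f x\<bar> \<le> e')"
proof -
  obtain F where F: "finite F" "F \<subseteq> K" "K \<subseteq> (\<Union>y\<in>F. ball y (e' / 2))"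
    using compactE_image[OF K, of K "\<lambda>y. ball y (e' / 2)"] e' by force
  have fF: "f \<in> Katetov_maps F"
    using f F(2) Katetov_maps_mono by blast
  have "\<exists>z'. dist z' z \<le> e \<and> (\<forall>x\<in>F. dist z' x = f x)"
  proof (cases "z \<in> F \<or> F = {}")
    \<comment> \<open>For \<open>z\<close> in the net the value at \<open>z\<close> is already fixed
      as \<open>f z\<close>, which is at most \<open>e\<close>; for an empty net \<open>z\<close>
      itself can be kept.\<close>
    case True
    then show ?thesis
    proof
      assume zF: "z \<in> F"
      obtain z' where z': "\<forall>x\<in>F. dist z' x = f x"
        using realize_finite_Katetov_map[OF U F(1) fF] by blast
      moreover have "f z \<le> e" using z[of z] zF F(2) by auto
      ultimately show ?thesis using zF by (metis dist_commute)
    qed (use e in \<open>auto intro: exI[of _ z]\<close>)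
  next
    case False
    define c where "c = Max ((\<lambda>x. \<bar>dist z x - f x\<bar>) ` F)"
    have c: "\<bar>dist z x - f x\<bar> \<le> c" if "x \<in> F" for x
      unfolding c_def using that F(1) by (intro Max_ge) auto
    have "c \<in> (\<lambda>x. \<bar>dist z x - f x\<bar>) ` F"
      unfolding c_def using False F(1) by (intro Max_in) auto
    then obtain x0 where x0: "x0 \<in> F" "c = \<bar>dist z x0 - f x0\<bar>" by blast
    have ce: "c \<le> e" using x0 z F(2) by auto
    \<comment> \<open>The maximum \<open>c\<close> is attained at \<open>x0\<close>; from there the
      bound is carried to \<open>x\<close> by the triangle inequality and the Katetov inequalities
      of \<open>f\<close>.\<close>
    have c2: "c \<le> f x + dist x z" if "x \<in> F" for x
      using x0(2) Katetov_mapsD(1,2)[OF fF x0(1) that] dist_triangle[of z x0 x] dist_triangle[of x0 x z]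
        dist_triangle[of x x0 z]
      by (simp add: abs_if dist_commute split: if_splits)
    have "f(z := c) \<in> Katetov_maps (insert z F)"
    proof (rule Katetov_mapsI)
      have c0: "0 \<le> c" using x0(2) by simp
      fix x y assume "x \<in> insert z F" "y \<in> insert z F"
      then show "(f(z := c)) x \<le> (f(z := c)) y + dist x y"
        "dist x y \<le> (f(z := c)) x + (f(z := c)) y"
        using c[of x] c[of y] c2[of x] c2[of y] Katetov_mapsD(1,2)[OF fF, of x y] c0
        by (auto simp: dist_commute abs_le_iff)
    qed
    then obtain z' where z': "\<forall>x\<in>insert z F. dist z' x = (f(z := c)) x"
      using realize_finite_Katetov_map[OF U] F(1) by (metis finite_insert)
    then have "dist z' z \<le> e" using ce by simp
    moreover have "\<forall>x\<in>F. dist z' x = f x" using z' False by auto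
    ultimately show ?thesis by blast
  qed
  then obtain z' where z': "dist z' z \<le> e" "\<forall>x\<in>F. dist z' x = f x" by blast
  have "\<forall>x\<in>K. \<bar>dist z' x - f x\<bar> \<le> e'"
    using approximate_on_net[OF f F(2,3)] z'(2) by blast
  with z'(1) show ?thesis by (auto simp: dist_commute)
qed

text \<open>Successive improvement yields points \<open>z n\<close> with error at most
  \<open>(1/2)^n\<close> on all of \<open>K\<close> and steps of length at most
  \<open>(1/2)^n\<close>; they form a Cauchy sequence, and its limit has error 0.\<close>

lemma realize_compact_Katetov_map:
  fixes K :: "'u::complete_space set"
  assumes U: "finitely_injective (UNIV :: 'u set)"
    and K: "compact K" and f: "f \<in> Katetov_maps K"
  shows "\<exists>z. \<forall>x\<in>K. dist z x = f x"
proof -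
  let ?P = "\<lambda>n z. \<forall>x\<in>K. \<bar>dist z x - f x\<bar> \<le> (1/2::real)^n"
  have "\<exists>z. ?P 0 z"
  proof -
    obtain F where F: "finite F" "F \<subseteq> K" "K \<subseteq> (\<Union>y\<in>F. ball y (1 / 2))"
      using compactE_image[OF K, of K "\<lambda>y. ball y (1 / 2)"] by force
    obtain z where "\<forall>x\<in>F. dist z x = f x"
      using realize_finite_Katetov_map[OF U F(1)] f F(2) Katetov_maps_mono by blast
    then show ?thesis
      using approximate_on_net[OF f F(2), of 1] F(3) by (intro exI[of _ z]) auto
  qed
  moreover have "\<exists>z'. ?P (Suc n) z' \<and> dist z z' \<le> (1/2)^n" if "?P n z" for n z
    using improve_approximation[OF U K f, of z "(1/2)^n" "(1/2)^Suc n"] that by auto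
  ultimately obtain z where z: "\<And>n. ?P n (z n)" "\<And>n. dist (z n) (z (Suc n)) \<le> (1/2)^n"
    using dependent_nat_choice[of ?P "\<lambda>n z z'. dist z z' \<le> (1/2)^n"] by blast
  \<comment> \<open>The bound is the geometric sum of the steps from \<open>n\<close> to
    \<open>n + k - 1\<close>.\<close>
  have dz: "dist (z n) (z (n + k)) \<le> 2 * (1/2)^n - 2 * (1/2)^(n + k)" for n k
  proof (induction k)
    case (Suc k)
    have "dist (z n) (z (n + Suc k)) \<le> dist (z n) (z (n + k)) + dist (z (n + k)) (z (Suc (n + k)))"
      by (metis add_Suc_right dist_triangle)
    moreover have "(1/2::real) ^ (n + Suc k) = (1/2) ^ (n + k) / 2" by simp
    ultimately show ?case using Suc.IH z(2)[of "n + k"] by simp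
  qed simp
  have half0: "(\<lambda>n. (1/2::real)^n) \<longlonglongrightarrow> 0"
    by (rule LIMSEQ_realpow_zero) auto
  have "Cauchy z"
  proof (rule metric_CauchyI)
    fix e :: real assume "0 < e"
    then obtain N where N: "(1/2::real)^N < e / 4"
      using real_arch_pow_inv[of "e/4" "1/2"] by auto
    have *: "dist (z N) (z m) < e / 2" if "m \<ge> N" for m
    proof -
      have "dist (z N) (z m) \<le> 2 * (1/2)^N - 2 * (1/2)^m"
        using dz[of N "m - N"] that by simp
      moreover have "(0::real) \<le> (1/2)^m" by simp
      ultimately show ?thesis using N by linarith
    qed
    have "dist (z m) (z n) < e" if "m \<ge> N" "n \<ge> N" for m n
      using *[OF that(1)] *[OF that(2)] dist_triangle3[of "z m" "z n" "z N"] by linarith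
    then show "\<exists>M. \<forall>m\<ge>M. \<forall>n\<ge>M. dist (z m) (z n) < e" by blast
  qed
  then obtain w where w: "z \<longlonglongrightarrow> w"
    using Cauchy_convergent convergent_def by blast
  have "dist w x = f x" if x: "x \<in> K" for x
  proof -
    have "(\<lambda>n. \<bar>dist (z n) x - f x\<bar>) \<longlonglongrightarrow> \<bar>dist w x - f x\<bar>"
      by (intro tendsto_intros w)
    then have "\<bar>dist w x - f x\<bar> \<le> 0"
      using z(1) x by (intro LIMSEQ_le[OF _ half0]) auto
    then show ?thesis by simp
  qed
  then show ?thesis by blast
qed

section \<open>Back and forth\<close>

text \<open>A partial isometry is represented by its graph: exchanging domain and range is then a
  swap, and adjoining a point is an insertion.\<close>

definition isometric_relation :: "('a::metric_space \<times> 'b::metric_space) set \<Rightarrow> bool" where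
  "isometric_relation S \<longleftrightarrow> (\<forall>p\<in>S. \<forall>q\<in>S. dist (fst p) (fst q) = dist (snd p) (snd q))"

lemma isometric_relation_swap:
  "isometric_relation (prod.swap ` S) \<longleftrightarrow> isometric_relation S"
  by (force simp: isometric_relation_def)

lemma isometric_relation_Un_chain:
  assumes "\<And>n. isometric_relation (S n)" "\<And>n. S n \<subseteq> S (Suc n)"
  shows "isometric_relation (\<Union>n. S n)"
  unfolding isometric_relation_def
proof (intro ballI)
  fix p q assume "p \<in> (\<Union>n. S n)" "q \<in> (\<Union>n. S n)"
  then obtain m n where "p \<in> S m" "q \<in> S n" by blast
  moreover have "S m \<subseteq> S (max m n)" "S n \<subseteq> S (max m n)"
    using lift_Suc_mono_le[of S] assms(2) by auto
  ultimately show "dist (fst p) (fst q) = dist (snd p) (snd q)"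
    using assms(1)[of "max m n"] unfolding isometric_relation_def by blast
qed

text \<open>The relation is the graph of an isometry with dense domain, which extends to the whole
  space. The range of the extension is closed, as it is complete, and contains a dense set.\<close>

lemma dense_isometric_relation_extends:
  fixes S :: "('u::complete_space \<times> 'u) set"
  assumes S: "isometric_relation S"
    and d1: "closure (fst ` S) = UNIV" and d2: "closure (snd ` S) = UNIV"
  shows "\<exists>\<psi>\<in>Iso (UNIV :: 'u set). \<forall>(x, y)\<in>S. \<psi> x = y"
proof -
  have inj: "snd p = snd q" if "p \<in> S" "q \<in> S" "fst p = fst q" for p q
    using S that by (metis dist_eq_0_iff isometric_relation_def)
  define g where "g x = (SOME y. (x, y) \<in> S)" for x
  have gS: "(x, g x) \<in> S" if "x \<in> fst ` S" for x
    using that unfolding g_def by (auto intro: someI)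
  have g: "g x = y" if "(x, y) \<in> S" for x y
    using inj[OF gS[of x] that] that image_eqI[of x fst "(x, y)" S] by simp
  have "dist (g x) (g y) = dist x y" if "x \<in> fst ` S" "y \<in> fst ` S" for x y
    using gS[OF that(1)] gS[OF that(2)] S unfolding isometric_relation_def by fastforce
  then obtain h where h: "\<And>x. x \<in> fst ` S \<Longrightarrow> h x = g x" "\<And>x y. dist (h x) (h y) = dist x y"
    using isometric_extension_on_closure[of "fst ` S" g] d1 by (metis UNIV_I)
  have "closed (range h)"
    unfolding closed_sequential_limits
  proof (intro allI impI, elim conjE)
    fix f l assume f: "\<forall>n. f n \<in> range h" "f \<longlonglongrightarrow> l"
    then have "\<forall>n. \<exists>a. f n = h a" by blast
    then obtain x where x: "\<And>n. f n = h (x n)" by metis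
    have "Cauchy f" using f(2) by (rule LIMSEQ_imp_Cauchy)
    then have "Cauchy x" unfolding Cauchy_def x h(2) .
    then obtain a where a: "x \<longlonglongrightarrow> a"
      using Cauchy_convergent convergent_def by blast
    then have "(\<lambda>n. dist (x n) a) \<longlonglongrightarrow> 0"
      using tendsto_dist_iff by blast
    then have "(\<lambda>n. dist (f n) (h a)) \<longlonglongrightarrow> 0" by (simp add: x h(2))
    then have "f \<longlonglongrightarrow> h a" using tendsto_dist_iff by blast
    then show "l \<in> range h" using f(2) LIMSEQ_unique by blast
  qed
  moreover have "snd ` S \<subseteq> range h"
  proof (rule image_subsetI)
    fix p assume "p \<in> S"
    then have "snd p = h (fst p)" using g[of "fst p" "snd p"] h(1) by simp
    then show "snd p \<in> range h" by simp
  qed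
  ultimately have "range h = UNIV"
    using d2 closure_minimal by blast
  then have "h \<in> Iso UNIV"
    using h(2) by (simp add: Iso_def isometry_def)
  moreover have "\<forall>(x, y)\<in>S. h x = y"
    using g h(1) by force
  ultimately show ?thesis by blast
qed

text \<open>The distances demanded of \<open>v\<close> are those of \<open>u\<close> to the
  corresponding first coordinates; they form a Katetov map on the second projection, which is
  compact as \<open>S\<close> is.\<close>

lemma isometric_relation_extend_fst:
  fixes S :: "('u::complete_space \<times> 'u) set"
  assumes U: "finitely_injective (UNIV :: 'u set)"
    and S: "compact S" "isometric_relation S"
  shows "\<exists>v. isometric_relation (insert (u, v) S)"
proof -
  have inj: "fst p = fst q" if "p \<in> S" "q \<in> S" "snd p = snd q" for p q
    using S that by (metis dist_eq_0_iff isometric_relation_def)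
  define g where "g y = (SOME x. (x, y) \<in> S)" for y
  have gS: "(g y, y) \<in> S" if "y \<in> snd ` S" for y
    using that unfolding g_def by (auto intro: someI)
  have g: "g y = x" if "(x, y) \<in> S" for x y
    using inj[OF gS[of y] that] that image_eqI[of y snd "(x, y)" S] by simp
  have gd: "dist (g x) (g y) = dist x y" if "x \<in> snd ` S" "y \<in> snd ` S" for x y
    using gS[OF that(1)] gS[OF that(2)] S(2) unfolding isometric_relation_def by fastforce
  have "compact (snd ` S)"
    using S(1) by (intro compact_continuous_image continuous_intros)
  moreover have "(\<lambda>y. dist u (g y)) \<in> Katetov_maps (snd ` S)"
  proof (rule Katetov_mapsI)
    fix x y assume "x \<in> snd ` S" "y \<in> snd ` S"
    note gd[OF this, symmetric]
    then show "dist u (g x) \<le> dist u (g y) + dist x y" "dist x y \<le> dist u (g x) + dist u (g y)"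
      by (simp_all add: dist_triangle2 dist_triangle3)
  qed
  ultimately obtain v where "\<forall>y\<in>snd ` S. dist v y = dist u (g y)"
    using realize_compact_Katetov_map[OF U] by meson
  then have "dist v y = dist u x" if "(x, y) \<in> S" for x y
    using that g by force
  then have "isometric_relation (insert (u, v) S)"
    using S(2) unfolding isometric_relation_def by (auto simp: dist_commute)
  then show ?thesis by blast
qed

lemma isometric_relation_extend_snd:
  fixes S :: "('u::complete_space \<times> 'u) set"
  assumes U: "finitely_injective (UNIV :: 'u set)"
    and S: "compact S" "isometric_relation S"
  shows "\<exists>u. isometric_relation (insert (u, v) S)"
proof -
  have "compact (prod.swap ` S)"
    using S(1) by (intro compact_continuous_image continuous_on_swap)
  then obtain u where "isometric_relation (insert (v, u) (prod.swap ` S))"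
    using isometric_relation_extend_fst[OF U] S(2) isometric_relation_swap by blast
  then have "isometric_relation (prod.swap ` insert (u, v) S)" by simp
  then show ?thesis using isometric_relation_swap by blast
qed

lemma dense_sequence_polish:
  obtains q :: "nat \<Rightarrow> 'u::polish_space" where "closure (range q) = UNIV"
proof -
  obtain D :: "'u set" where D: "countable D" "\<And>X. open X \<Longrightarrow> X \<noteq> {} \<Longrightarrow> \<exists>d\<in>D. d \<in> X"
    using countable_dense_setE by blast
  have "D \<noteq> {}" using D(2)[of UNIV] by auto
  have "closure D = UNIV"
    using D(2)[of "- closure D"] closure_subset[of D] by auto
  then show ?thesis
    using that[of "from_nat_into D"] range_from_nat_into[OF \<open>D \<noteq> {}\<close> D(1)] by simp
qed

text \<open>Back and forth along one dense sequence \<open>q\<close>: stage \<open>n\<close> puts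
  \<open>q n\<close> into both the domain and the range. Adding two pairs keeps the relation
  compact, so the next stage can proceed; the union has dense projections.\<close>

lemma compact_homogeneity:
  fixes X1 X2 :: "'u::polish_space set"
  assumes U: "finitely_injective (UNIV :: 'u set)"
    and X1: "compact X1" and \<phi>: "isometry \<phi> X1 X2"
  shows "\<exists>\<psi>\<in>Iso (UNIV :: 'u set). \<forall>x\<in>X1. \<psi> x = \<phi> x"
proof -
  obtain q :: "nat \<Rightarrow> 'u" where q: "closure (range q) = UNIV"
    using dense_sequence_polish .
  define S0 where "S0 = (\<lambda>x. (x, \<phi> x)) ` X1"
  have d\<phi>: "\<And>x y. x \<in> X1 \<Longrightarrow> y \<in> X1 \<Longrightarrow> dist (\<phi> x) (\<phi> y) = dist x y"
    using \<phi> by (auto simp: isometry_def)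
  then have "continuous_on X1 \<phi>"
    unfolding continuous_on_iff by metis
  then have S0: "compact S0" "isometric_relation S0"
    using X1 d\<phi> unfolding S0_def isometric_relation_def
    by (auto intro!: compact_continuous_image continuous_intros)
  let ?P = "\<lambda>n S. compact S \<and> isometric_relation S \<and> S0 \<subseteq> S"
  let ?Q = "\<lambda>n S S'. S \<subseteq> S' \<and> q n \<in> fst ` S' \<and> q n \<in> snd ` S'"
  have step: "\<exists>S'. ?P (Suc n) S' \<and> ?Q n S S'" if S: "?P n S" for S n
  proof -
    obtain v where v: "isometric_relation (insert (q n, v) S)"
      using isometric_relation_extend_fst[OF U] S by blast
    then obtain u where u: "isometric_relation (insert (u, q n) (insert (q n, v) S))"
      using isometric_relation_extend_snd[OF U compact_insert] S by blast
    show ?thesis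
      using u S by (intro exI[of _ "insert (u, q n) (insert (q n, v) S)"]) (auto intro: compact_insert)
  qed
  have "?P 0 S0" using S0 by simp
  then have ex0: "\<exists>S. ?P 0 S" by blast
  obtain S where S: "\<And>n. ?P n (S n)" "\<And>n. ?Q n (S n) (S (Suc n))"
    using dependent_nat_choice[of ?P ?Q, OF ex0 step] by blast
  define T where "T = (\<Union>n. S n)"
  have T: "isometric_relation T"
    unfolding T_def using S by (intro isometric_relation_Un_chain) auto
  have "range q \<subseteq> fst ` T" "range q \<subseteq> snd ` T"
    unfolding T_def using S(2) by blast+
  then have "closure (fst ` T) = UNIV" "closure (snd ` T) = UNIV"
    using closure_mono[of "range q"] q by auto
  then obtain \<psi> where "\<psi> \<in> Iso (UNIV :: 'u set)" "\<forall>(x, y)\<in>T. \<psi> x = y"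
    using dense_isometric_relation_extends[OF T] by blast
  moreover have "S0 \<subseteq> T" using S(1) unfolding T_def by blast
  ultimately have "\<psi> \<in> Iso UNIV" "\<forall>x\<in>X1. \<psi> x = \<phi> x" by (auto simp: S0_def)
  then show ?thesis by blast
qed

section \<open>Embeddings with prescribed distance functions\<close>

text \<open>A pair \<open>(u, s)\<close> stands for a point \<open>u\<close> of the Urysohn space together with its prospective distances
  \<open>s\<close> to \<open>X\<close>; compatible pairs are those that satisfy the triangle inequality across the two
  spaces.\<close>

definition compatible :: "'a::metric_space set \<Rightarrow> 'u::metric_space \<times> ('a \<Rightarrow> real) \<Rightarrow> 'u \<times> ('a \<Rightarrow> real) \<Rightarrow> bool" where
  "compatible X p q \<longleftrightarrow>
     (\<forall>x\<in>X. \<bar>snd p x - snd q x\<bar> \<le> dist (fst p) (fst q) \<and> dist (fst p) (fst q) \<le> snd p x + snd q x)"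

lemma compatible_sym: "compatible X p q \<longleftrightarrow> compatible X q p"
  unfolding compatible_def by (auto simp: dist_commute abs_minus_commute add.commute)

lemma compatible_refl: "snd p \<in> Katetov_maps X \<Longrightarrow> compatible X p p"
  unfolding compatible_def using Katetov_mapsD(3)[of "snd p" X] by auto

lemma compatibleD:
  assumes "compatible X p q" "x \<in> X"
  shows "snd p x \<le> snd q x + dist (fst p) (fst q)" "snd q x \<le> snd p x + dist (fst p) (fst q)"
    "dist (fst p) (fst q) \<le> snd p x + snd q x"
  using assms unfolding compatible_def by (auto simp: abs_le_iff)

text \<open>Shortest route from \<open>u\<close> to \<open>x\<close> through a point of
  \<open>M\<close>. The triangle inequality with every \<open>p\<close> in \<open>M\<close> confines
  the distance from \<open>u\<close> to \<open>x\<close> to the interval from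
  \<open>minimal_extension\<close> to this value.\<close>

definition maximal_extension :: "'u::metric_space \<Rightarrow> ('u \<times> ('a \<Rightarrow> real)) set \<Rightarrow> 'a \<Rightarrow> real" where
  "maximal_extension u M x = Min ((\<lambda>p. dist u (fst p) + snd p x) ` M)"

definition minimal_extension :: "'u::metric_space \<Rightarrow> ('u \<times> ('a \<Rightarrow> real)) set \<Rightarrow> 'a \<Rightarrow> real" where
  "minimal_extension u M x = Max ((\<lambda>p. \<bar>dist u (fst p) - snd p x\<bar>) ` M)"

lemma maximal_extension_le:
  "finite M \<Longrightarrow> p \<in> M \<Longrightarrow> maximal_extension u M x \<le> dist u (fst p) + snd p x"
  unfolding maximal_extension_def by (intro Min_le) auto

lemma maximal_extension_attained:
  assumes "finite M" "M \<noteq> {}"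
  obtains p where "p \<in> M" "maximal_extension u M x = dist u (fst p) + snd p x"
proof -
  have "maximal_extension u M x \<in> (\<lambda>p. dist u (fst p) + snd p x) ` M"
    unfolding maximal_extension_def using assms by (intro Min_in) auto
  then show ?thesis using that by blast
qed

lemma minimal_extension_ge:
  "finite M \<Longrightarrow> p \<in> M \<Longrightarrow> \<bar>dist u (fst p) - snd p x\<bar> \<le> minimal_extension u M x"
  unfolding minimal_extension_def by (intro Max_ge) auto

lemma minimal_extension_attained:
  assumes "finite M" "M \<noteq> {}"
  obtains p where "p \<in> M" "minimal_extension u M x = \<bar>dist u (fst p) - snd p x\<bar>"
proof -
  have "minimal_extension u M x \<in> (\<lambda>p. \<bar>dist u (fst p) - snd p x\<bar>) ` M"
    unfolding minimal_extension_def using assms by (intro Max_in) auto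
  then show ?thesis using that by blast
qed

text \<open>The interval of admissible distances from \<open>u\<close> to \<open>x\<close> is
  nonempty: pairs attaining its two ends are compared through the distance of their points, which
  compatibility ties to their values at \<open>x\<close>.\<close>

lemma minimal_extension_le_maximal:
  assumes M: "finite M" "M \<noteq> {}" "\<And>p q. p \<in> M \<Longrightarrow> q \<in> M \<Longrightarrow> compatible X p q" and x: "x \<in> X"
  shows "minimal_extension u M x \<le> maximal_extension u M x"
proof -
  obtain p where p: "p \<in> M" "maximal_extension u M x = dist u (fst p) + snd p x"
    using maximal_extension_attained[OF M(1,2)] .
  obtain q where q: "q \<in> M" "minimal_extension u M x = \<bar>dist u (fst q) - snd q x\<bar>"
    using minimal_extension_attained[OF M(1,2)] .
  show ?thesis
    using compatibleD[OF M(3)[OF p(1) q(1)] x] p(2) q(2) dist_triangle[of u "fst q" "fst p"]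
      dist_triangle[of "fst p" "fst q" u]
    by (auto simp: dist_commute abs_le_iff)
qed

lemma compatible_between:
  assumes "finite M" "p \<in> M"
    and "\<And>x. x \<in> X \<Longrightarrow> minimal_extension u M x \<le> t x"
    and "\<And>x. x \<in> X \<Longrightarrow> t x \<le> maximal_extension u M x"
  shows "compatible X p (u, t)"
  unfolding compatible_def
proof
  fix x assume "x \<in> X"
  then show "\<bar>snd p x - snd (u, t) x\<bar> \<le> dist (fst p) (fst (u, t)) \<and>
      dist (fst p) (fst (u, t)) \<le> snd p x + snd (u, t) x"
    using assms(3,4)[of x] maximal_extension_le[OF assms(1,2), of u x]
      minimal_extension_ge[OF assms(1,2), of u x]
    by (auto simp: dist_commute abs_le_iff)
qed

text \<open>The function projects \<open>k\<close> onto the interval between the minimal and the maximal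
  extension. The minimal extension alone need not satisfy the second Katetov inequality.\<close>

lemma median_extension_in_Katetov_maps:
  fixes M :: "('u::metric_space \<times> ('a::metric_space \<Rightarrow> real)) set"
  assumes M: "finite M" "M \<noteq> {}" "\<And>p. p \<in> M \<Longrightarrow> snd p \<in> Katetov_maps X"
      "\<And>p q. p \<in> M \<Longrightarrow> q \<in> M \<Longrightarrow> compatible X p q"
    and k: "k \<in> Katetov_maps X"
  shows "(\<lambda>x. min (maximal_extension u M x) (max (minimal_extension u M x) (k x))) \<in> Katetov_maps X"
proof -
  let ?m = "maximal_extension u M" and ?h = "minimal_extension u M"
  have mL: "?m x \<le> ?m y + dist x y" if "x \<in> X" "y \<in> X" for x y
  proof -
    obtain p where p: "p \<in> M" "?m y = dist u (fst p) + snd p y"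
      using maximal_extension_attained[OF M(1,2)] .
    show ?thesis
      using maximal_extension_le[OF M(1) p(1), of u x] Katetov_mapsD(1)[OF M(3)[OF p(1)] that] p(2)
      by simp
  qed
  have hL: "?h x \<le> ?h y + dist x y" if "x \<in> X" "y \<in> X" for x y
  proof -
    obtain p where p: "p \<in> M" "?h x = \<bar>dist u (fst p) - snd p x\<bar>"
      using minimal_extension_attained[OF M(1,2)] .
    show ?thesis
      using minimal_extension_ge[OF M(1) p(1), of u y] Katetov_mapsD(1)[OF M(3)[OF p(1)] that]
        Katetov_mapsD(1)[OF M(3)[OF p(1)] that(2,1)] p(2)
      by (auto simp: dist_commute abs_le_iff)
  qed
  \<comment> \<open>If one of the two values is the maximal one, this suffices, since the other is
    at least minimal; otherwise both are at least the values of \<open>k\<close>, which is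
    Katetov.\<close>
  have mh: "dist x y \<le> ?m x + ?h y" if "x \<in> X" "y \<in> X" for x y
  proof -
    obtain p where p: "p \<in> M" "?m x = dist u (fst p) + snd p x"
      using maximal_extension_attained[OF M(1,2)] .
    show ?thesis
      using minimal_extension_ge[OF M(1) p(1), of u y] Katetov_mapsD(2)[OF M(3)[OF p(1)] that] p(2)
      by (auto simp: abs_le_iff)
  qed
  have hm: "?h x \<le> ?m x" if "x \<in> X" for x
    using minimal_extension_le_maximal[OF M(1,2,4) that] by blast
  show ?thesis
  proof (rule Katetov_mapsI)
    fix x y assume xy: "x \<in> X" "y \<in> X"
    show "min (?m x) (max (?h x) (k x)) \<le> min (?m y) (max (?h y) (k y)) + dist x y"
      using mL[OF xy] hL[OF xy] Katetov_mapsD(1)[OF k xy] by (auto simp: min_def max_def)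
    show "dist x y \<le> min (?m x) (max (?h x) (k x)) + min (?m y) (max (?h y) (k y))"
      using mh[OF xy] mh[OF xy(2,1)] hm[OF xy(1)] hm[OF xy(2)] Katetov_mapsD(2)[OF k xy]
      by (auto simp: min_def max_def dist_commute)
  qed
qed

text \<open>For the second Katetov inequality, the shortest routes to \<open>x\<close> via
  \<open>p\<close> and to \<open>y\<close> via \<open>q\<close> are joined at \<open>u\<close>:
  compatibility bounds \<open>snd q x\<close> by \<open>snd p x\<close> plus the distance of the two
  points, and \<open>snd q\<close> is Katetov.\<close>

lemma maximal_extension_in_Katetov_maps:
  fixes M :: "('u::metric_space \<times> ('a::metric_space \<Rightarrow> real)) set"
  assumes M: "finite M" "M \<noteq> {}" "\<And>p. p \<in> M \<Longrightarrow> snd p \<in> Katetov_maps X"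
      "\<And>p q. p \<in> M \<Longrightarrow> q \<in> M \<Longrightarrow> compatible X p q"
  shows "maximal_extension u M \<in> Katetov_maps X"
proof (rule Katetov_mapsI)
  fix x y assume xy: "x \<in> X" "y \<in> X"
  obtain p where p: "p \<in> M" "maximal_extension u M x = dist u (fst p) + snd p x"
    using maximal_extension_attained[OF M(1,2)] .
  obtain q where q: "q \<in> M" "maximal_extension u M y = dist u (fst q) + snd q y"
    using maximal_extension_attained[OF M(1,2)] .
  show "maximal_extension u M x \<le> maximal_extension u M y + dist x y"
    using maximal_extension_le[OF M(1) q(1), of u x] Katetov_mapsD(1)[OF M(3)[OF q(1)] xy] q(2)
    by simp
  show "dist x y \<le> maximal_extension u M x + maximal_extension u M y"
    using p(2) q(2) Katetov_mapsD(2)[OF M(3)[OF q(1)] xy] compatibleD(2)[OF M(4)[OF p(1) q(1)] xy(1)]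
      dist_triangle3[of "fst p" "fst q" u]
    by simp
qed

section \<open>Copies of a separable space built from a class of traces\<close>

lemma dense_sequence_separable:
  fixes X :: "'a::metric_space set"
  assumes X: "separable_space (top_of_set X)" "X \<noteq> {}"
  obtains a :: "nat \<Rightarrow> 'a" where "range a \<subseteq> X" "X \<subseteq> closure (range a)"
proof -
  obtain C where C: "countable C" "C \<subseteq> X" "X \<subseteq> closure C"
    using X(1) closure_of_subtopology_subset[of euclidean X]
    unfolding separable_space_def topspace_euclidean_subtopology
    by (metis euclidean_closure_of)
  then have "C \<noteq> {}" using X(2) by auto
  then show ?thesis
    using that[of "from_nat_into C"] range_from_nat_into[OF _ C(1)] C(2,3) by simp
qed

text \<open>A trace is the distance function from a point of the ambient space to a copy of
  \<open>X\<close>. The conditions are those of an inductive construction: the points of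
  \<open>X\<close> themselves have admissible traces, and every further point \<open>u\<close> can
  be given one compatible with finitely many earlier choices. The first argument only fixes the type
  of \<open>u\<close>.\<close>

definition amalgamating :: "'u::metric_space itself \<Rightarrow> 'a::metric_space set \<Rightarrow> ('a \<Rightarrow> real) set \<Rightarrow> bool" where
  "amalgamating _ X T \<longleftrightarrow>
     T \<subseteq> Katetov_maps X \<and> (\<forall>a\<in>X. dist a \<in> T) \<and>
     (\<forall>(u :: 'u) M. finite M \<and> M \<noteq> {} \<and> M \<subseteq> UNIV \<times> T \<and> (\<forall>p\<in>M. \<forall>q\<in>M. compatible X p q) \<longrightarrow>
        (\<exists>t\<in>T. \<forall>p\<in>M. compatible X p (u, t)))"

text \<open>Pairs \<open>w n = (u\<^sub>n, t\<^sub>n)\<close> with \<open>t\<^sub>n \<in> T\<close> are chosen so that at odd stages \<open>t\<^sub>n\<close> is the distance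
  to the next point of a dense sequence of \<open>X\<close> (so \<open>u\<^sub>n\<close> becomes its image) and at even stages
  \<open>u\<^sub>n\<close> is the next point of a dense sequence of the Urysohn space.\<close>

lemma embedding_with_prescribed_traces:
  fixes X :: "'a::metric_space set"
  assumes U: "finitely_injective (UNIV :: 'u::polish_space set)"
    and X: "separable_space (top_of_set X)" "X \<noteq> {}"
    and T: "amalgamating TYPE('u::polish_space) X T" and t0: "t0 \<in> T"
  shows "\<exists>(j :: 'a \<Rightarrow> 'u::polish_space) z. isometry j X (j ` X) \<and> (\<forall>x\<in>X. dist z (j x) = t0 x) \<and>
    (\<forall>z. \<forall>e>0. \<exists>t\<in>T. \<forall>x\<in>X. \<bar>dist z (j x) - t x\<bar> \<le> e)"
proof -
  obtain q :: "nat \<Rightarrow> 'u" where q: "closure (range q) = UNIV"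
    using dense_sequence_polish .
  obtain a :: "nat \<Rightarrow> 'a" where a: "range a \<subseteq> X" "X \<subseteq> closure (range a)"
    using dense_sequence_separable[OF X] .
  have aX: "a k \<in> X" for k using a(1) by auto
  have TK: "T \<subseteq> Katetov_maps X" and dT: "\<And>a. a \<in> X \<Longrightarrow> dist a \<in> T"
    using T by (auto simp: amalgamating_def)
  \<comment> \<open>Stage 0 is reserved for the trace \<open>t0\<close>; this shifts the index of
    \<open>q\<close> at the later even stages by one.\<close>
  define P :: "(nat \<Rightarrow> 'u \<times> ('a \<Rightarrow> real)) \<Rightarrow> nat \<Rightarrow> 'u \<times> ('a \<Rightarrow> real) \<Rightarrow> bool"
    where "P w n r \<longleftrightarrow> snd r \<in> T \<and> (\<forall>m<n. compatible X (w m) r) \<and> (n = 0 \<longrightarrow> snd r = t0) \<and>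
      (odd n \<longrightarrow> snd r = dist (a (n div 2))) \<and> (even n \<and> n \<noteq> 0 \<longrightarrow> fst r = q (n div 2 - 1))" for w n r
  have "\<exists>w. \<forall>n. P w n (w n)"
  proof (rule dependent_wellorder_choice)
    show "P f n r = P g n r" if "\<And>m. m < n \<Longrightarrow> f m = g m" for r f g n
      using that by (simp add: P_def)
    fix n w assume IH: "\<And>m. m < n \<Longrightarrow> P w m (w m)"
    define M where "M = w ` {..<n}"
    have M: "finite M" "M \<subseteq> UNIV \<times> T" and MK: "\<And>p. p \<in> M \<Longrightarrow> snd p \<in> Katetov_maps X"
    proof -
      have "snd (w m) \<in> T" if "m < n" for m using IH[OF that] by (simp add: P_def)
      then have *: "snd p \<in> T" if "p \<in> M" for p using that by (auto simp: M_def)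
      then show "M \<subseteq> UNIV \<times> T" "\<And>p. p \<in> M \<Longrightarrow> snd p \<in> Katetov_maps X"
        using TK by (simp_all add: subset_iff mem_Times_iff)
      show "finite M" by (simp add: M_def)
    qed
    have comp: "compatible X (w i) (w k)" if "i < n" "k < n" for i k
    proof (cases i k rule: linorder_cases)
      case equal
      have "w k \<in> M" using that(2) by (simp add: M_def)
      then show ?thesis using compatible_refl[OF MK] equal by simp
    next
      case less then show ?thesis using IH[OF that(2)] by (simp add: P_def)
    next
      case greater then show ?thesis using IH[OF that(1)] by (simp add: P_def compatible_sym[of X "w i"])
    qed
    then have MM: "\<forall>p\<in>M. \<forall>q\<in>M. compatible X p q" by (auto simp: M_def)
    consider "n = 0" | "odd n" | "even n" "n \<noteq> 0" by blast
    then show "\<exists>r. P w n r"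
    proof cases
      case 1
      \<comment> \<open>No earlier point restricts the first one, so its position is
        arbitrary.\<close>
      then show ?thesis using t0 by (intro exI[of _ "(undefined, t0)"]) (simp add: P_def)
    next
      case 2
      define x where "x = a (n div 2)"
      have xX: "x \<in> X" unfolding x_def by (rule aX)
      \<comment> \<open>The trace values at \<open>x\<close> are to become the distances of the new
        point to the earlier ones. Compatible pairs over the same point have equal traces on
        \<open>X\<close>, so the choice of the pair does not matter.\<close>
      define f where "f v = (SOME r. \<exists>p\<in>M. fst p = v \<and> snd p x = r)" for v
      have f: "f (fst p) = snd p x" if "p \<in> M" for p
      proof -
        have "\<exists>p'\<in>M. fst p' = fst p \<and> snd p' x = f (fst p)"
          unfolding f_def by (rule someI) (use that in blast)
        then obtain p' where p': "p' \<in> M" "fst p' = fst p" "snd p' x = f (fst p)" by blast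
        then have "compatible X p' p" using MM that by blast
        from compatibleD(1,2)[OF this xX] show ?thesis using p' by simp
      qed
      have "f \<in> Katetov_maps (fst ` M)"
      proof (rule Katetov_mapsI)
        fix y z assume "y \<in> fst ` M" "z \<in> fst ` M"
        then obtain p p' where pp: "p \<in> M" "p' \<in> M" "y = fst p" "z = fst p'" by blast
        then have "compatible X p p'" using MM by blast
        from compatibleD[OF this xX] show "f y \<le> f z + dist y z" "dist y z \<le> f y + f z"
          using pp by (simp_all add: f)
      qed
      then obtain u where u: "\<forall>v\<in>fst ` M. dist u v = f v"
        using realize_finite_Katetov_map[OF U finite_imageI[OF M(1)]] by blast
      have "compatible X p (u, dist x)" if p: "p \<in> M" for p
        unfolding compatible_def
      proof
        fix y assume y: "y \<in> X"
        have "dist (fst p) u = snd p x"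
          using u p f[OF p] by (metis dist_commute imageI)
        then show "\<bar>snd p y - snd (u, dist x) y\<bar> \<le> dist (fst p) (fst (u, dist x)) \<and>
            dist (fst p) (fst (u, dist x)) \<le> snd p y + snd (u, dist x) y"
          using Katetov_mapsD[OF MK[OF p] xX y] Katetov_mapsD[OF MK[OF p] y xX]
          by (auto simp: abs_le_iff dist_commute)
      qed
      then have "P w n (u, dist x)"
        using 2 dT[OF xX] by (auto simp: P_def M_def x_def)
      then show ?thesis by blast
    next
      case 3
      then have "M \<noteq> {}" by (auto simp: M_def)
      then obtain t where "t \<in> T" "\<forall>p\<in>M. compatible X p (q (n div 2 - 1), t)"
        using T M MM unfolding amalgamating_def by meson
      then have "P w n (q (n div 2 - 1), t)"
        using 3 by (auto simp: P_def M_def)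
      then show ?thesis by blast
    qed
  qed
  then obtain w where w: "\<And>n. P w n (w n)" by blast
  define u where "u n = fst (w n)" for n
  define t where "t n = snd (w n)" for n
  have tT: "t n \<in> T" and tK: "t n \<in> Katetov_maps X" for n
    using w[of n] TK by (auto simp: P_def t_def)
  have "compatible X (w n) (w m)" for n m
  proof (cases n m rule: linorder_cases)
    case equal
    then show ?thesis using compatible_refl[of "w m" X] tK[of m] by (simp add: t_def)
  next
    case less then show ?thesis using w[of m] by (simp add: P_def)
  next
    case greater then show ?thesis using w[of n] by (simp add: P_def compatible_sym[of X "w n"])
  qed
  note comp = compatibleD[OF this, folded u_def t_def]
  have t_odd: "t (Suc (2 * k)) = dist (a k)" and u_even: "u (2 * k + 2) = q k" and t_0: "t 0 = t0" for k
    using w[of "Suc (2 * k)"] w[of "2 * k + 2"] w[of 0] by (auto simp: P_def t_def u_def)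
  \<comment> \<open>The trace at stage \<open>Suc (2 * k)\<close> vanishes at \<open>a k\<close>, so
    there the compatibility inequalities become an equality.\<close>
  have u_odd: "dist (u n) (u (Suc (2 * k))) = t n (a k)" for n k
    using comp[of "a k" n "Suc (2 * k)"] aX by (simp add: t_odd)
  define i where "i x = (SOME k. a k = x)" for x
  have i: "a (i x) = x" if "x \<in> range a" for x
    using that unfolding i_def by (auto intro: someI)
  have "dist (u (Suc (2 * i x))) (u (Suc (2 * i y))) = dist x y" if "x \<in> range a" "y \<in> range a" for x y
    using that by (simp only: u_odd t_odd i)
  then obtain j where j: "\<And>x. x \<in> range a \<Longrightarrow> j x = u (Suc (2 * i x))"
      "\<And>x y. x \<in> closure (range a) \<Longrightarrow> y \<in> closure (range a) \<Longrightarrow> dist (j x) (j y) = dist x y"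
    using isometric_extension_on_closure[of "range a" "\<lambda>x. u (Suc (2 * i x))"] by blast
  have jX: "dist (j x) (j y) = dist x y" if "x \<in> X" "y \<in> X" for x y
    using that a(2) by (intro j(2)) auto
  \<comment> \<open>The equation holds on the dense sequence, and both sides are 1-Lipschitz in
    \<open>x\<close>.\<close>
  have uj: "dist (u n) (j x) = t n x" if x: "x \<in> X" for n x
  proof -
    have "\<bar>dist (u n) (j x) - t n x\<bar> \<le> e" if e: "0 < e" for e
    proof -
      obtain y where y: "y \<in> range a" "dist y x < e / 2"
        using a(2) x e closure_approachable[of x "range a"] half_gt_zero by blast
      then have yX: "y \<in> X" using a(1) by blast
      have "dist (u n) (j y) = t n y" using y(1) by (simp only: u_odd j(1) i)
      then show ?thesis
        using jX[OF x yX] y(2) Katetov_mapsD(1)[OF tK[of n] x yX] Katetov_mapsD(1)[OF tK[of n] yX x]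
          dist_triangle2[of "u n" "j x" "j y"] dist_triangle[of "u n" "j y" "j x"]
        by (auto simp: dist_commute abs_le_iff)
    qed
    then have "\<bar>dist (u n) (j x) - t n x\<bar> \<le> 0"
      by (rule field_le_epsilon[where y = 0, simplified]) auto
    then show ?thesis by simp
  qed
  show ?thesis
  proof (intro exI conjI ballI allI impI)
    show "isometry j X (j ` X)" using jX by (simp add: isometry_def)
    show "dist (u 0) (j x) = t0 x" if "x \<in> X" for x using uj[OF that, of 0] t_0 by simp
    fix z :: 'u and e :: real assume e: "0 < e"
    \<comment> \<open>A point \<open>q k\<close> near \<open>z\<close> has its trace in
      \<open>T\<close>, and traces of nearby points are uniformly close.\<close>
    obtain k where k: "dist (q k) z < e"
      using q e closure_approachable[of z "range q"] by auto
    have "\<bar>dist z (j x) - t (2 * k + 2) x\<bar> \<le> e" if "x \<in> X" for x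
      using uj[OF that, of "2 * k + 2", unfolded u_even] k
        dist_triangle[of z "j x" "q k"] dist_triangle[of "q k" "j x" z]
      by (auto simp: dist_commute abs_le_iff)
    then show "\<exists>t\<in>T. \<forall>x\<in>X. \<bar>dist z (j x) - t x\<bar> \<le> e"
      using tT by blast
  qed
qed

section \<open>Amalgamating classes of traces\<close>

lemma amalgamating_dist: "amalgamating TYPE('u::metric_space) X T \<Longrightarrow> a \<in> X \<Longrightarrow> dist a \<in> T"
  by (simp add: amalgamating_def)

text \<open>This largest class serves to realize an arbitrary Katetov map over some copy of
  \<open>X\<close>; the maximal extension is the new trace.\<close>

lemma amalgamating_Katetov_maps: "amalgamating TYPE('u::metric_space) X (Katetov_maps X)"
  unfolding amalgamating_def
proof (intro conjI allI impI ballI)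
  fix u :: 'u and M :: "('u \<times> ('a \<Rightarrow> real)) set"
  assume "finite M \<and> M \<noteq> {} \<and> M \<subseteq> UNIV \<times> Katetov_maps X \<and> (\<forall>p\<in>M. \<forall>q\<in>M. compatible X p q)"
  then have M: "finite M" "M \<noteq> {}" "\<And>p. p \<in> M \<Longrightarrow> snd p \<in> Katetov_maps X"
      "\<And>p q. p \<in> M \<Longrightarrow> q \<in> M \<Longrightarrow> compatible X p q"
    by auto
  show "\<exists>t\<in>Katetov_maps X. \<forall>p\<in>M. compatible X p (u, t)"
    using maximal_extension_in_Katetov_maps[OF M] M(1) minimal_extension_le_maximal[OF M(1,2,4)]
    by (intro bexI[of _ "maximal_extension u M"] ballI compatible_between) auto
qed (auto simp: dist_in_Katetov_maps)

text \<open>Since \<open>t p + dist p x\<close> is never below \<open>t x\<close>, the condition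
  puts \<open>t\<close> within \<open>e\<close> of the largest 1-Lipschitz extension of its
  restriction to \<open>F\<close>.\<close>

definition nearly_finitely_supported :: "'a::metric_space set \<Rightarrow> ('a \<Rightarrow> real) set" where
  "nearly_finitely_supported X = {t \<in> Katetov_maps X.
     \<forall>e>0. \<exists>F. finite F \<and> F \<subseteq> X \<and> (\<forall>x\<in>X. \<exists>p\<in>F. t p + dist p x \<le> t x + e)}"

text \<open>Since \<open>t\<close> is Katetov, \<open>dist p (s n)\<close> is at most
  \<open>t (s n) + t p\<close>. Near equality says that a point with trace \<open>t\<close> lies
  almost on a shortest path from \<open>p\<close> to \<open>s n\<close>, for far \<open>n\<close>
  and some \<open>p\<close> from a finite set.\<close>

definition asymptotically_radial :: "'a::metric_space set \<Rightarrow> (nat \<Rightarrow> 'a) \<Rightarrow> ('a \<Rightarrow> real) set" where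
  "asymptotically_radial X s = {t \<in> Katetov_maps X.
     \<forall>e>0. \<exists>F. finite F \<and> F \<subseteq> X \<and> (\<forall>\<^sub>F n in sequentially. \<exists>p\<in>F. t (s n) + t p \<le> dist p (s n) + e)}"

text \<open>The maximal extension is a minimum of the finitely many traces in \<open>M\<close>
  shifted by constants, so the union of their finite supports works for it.\<close>

lemma amalgamating_nearly_finitely_supported:
  "amalgamating TYPE('u::metric_space) X (nearly_finitely_supported X)"
  unfolding amalgamating_def
proof (intro conjI allI impI ballI)
  show "dist a \<in> nearly_finitely_supported X" if "a \<in> X" for a
    unfolding nearly_finitely_supported_def using that
    by (auto simp: dist_in_Katetov_maps intro!: exI[of _ "{a}"])
  fix u :: 'u and M :: "('u \<times> ('a \<Rightarrow> real)) set"
  assume "finite M \<and> M \<noteq> {} \<and> M \<subseteq> UNIV \<times> nearly_finitely_supported X \<and>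
    (\<forall>p\<in>M. \<forall>q\<in>M. compatible X p q)"
  then have M: "finite M" "M \<noteq> {}" "\<And>p. p \<in> M \<Longrightarrow> snd p \<in> Katetov_maps X"
      "\<And>p q. p \<in> M \<Longrightarrow> q \<in> M \<Longrightarrow> compatible X p q"
    and T: "\<And>p. p \<in> M \<Longrightarrow> snd p \<in> nearly_finitely_supported X"
    by (auto simp: nearly_finitely_supported_def)
  let ?m = "maximal_extension u M"
  have "\<exists>F. finite F \<and> F \<subseteq> X \<and> (\<forall>x\<in>X. \<exists>p\<in>F. ?m p + dist p x \<le> ?m x + e)" if "0 < e" for e
  proof -
    have "\<forall>p\<in>M. \<exists>F. finite F \<and> F \<subseteq> X \<and> (\<forall>x\<in>X. \<exists>y\<in>F. snd p y + dist y x \<le> snd p x + e)"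
      using T that by (auto simp: nearly_finitely_supported_def)
    then obtain F where F: "\<And>p. p \<in> M \<Longrightarrow> finite (F p)" "\<And>p. p \<in> M \<Longrightarrow> F p \<subseteq> X"
        "\<And>p x. p \<in> M \<Longrightarrow> x \<in> X \<Longrightarrow> \<exists>y\<in>F p. snd p y + dist y x \<le> snd p x + e"
      by metis
    have "\<exists>y\<in>(\<Union>p\<in>M. F p). ?m y + dist y x \<le> ?m x + e" if x: "x \<in> X" for x
    proof -
      obtain p where p: "p \<in> M" "?m x = dist u (fst p) + snd p x"
        using maximal_extension_attained[OF M(1,2)] .
      obtain y where y: "y \<in> F p" "snd p y + dist y x \<le> snd p x + e"
        using F(3)[OF p(1) x] by blast
      have "?m y + dist y x \<le> ?m x + e"
        using maximal_extension_le[OF M(1) p(1), of u y] p(2) y(2) by simp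
      then show ?thesis using p(1) y(1) by blast
    qed
    then show ?thesis
      using M(1) F(1,2) by (intro exI[of _ "\<Union>p\<in>M. F p"] conjI UN_least finite_UN_I) auto
  qed
  then have "?m \<in> nearly_finitely_supported X"
    using maximal_extension_in_Katetov_maps[OF M] by (simp add: nearly_finitely_supported_def)
  then show "\<exists>t\<in>nearly_finitely_supported X. \<forall>p\<in>M. compatible X p (u, t)"
    using M minimal_extension_le_maximal[OF M(1,2,4)]
    by (intro bexI[of _ ?m] ballI compatible_between) auto
qed (auto simp: nearly_finitely_supported_def)

text \<open>The new trace is the median extension towards \<open>dist (s N)\<close> for a suitable
  \<open>N\<close>. At far \<open>s n\<close> it is either at most the distance to
  \<open>s N\<close>, and then \<open>x0\<close> is the required point \<open>p\<close>, or at most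
  a trace of \<open>M\<close> minus a constant, and then radiality is inherited from that
  trace.\<close>

lemma amalgamating_asymptotically_radial:
  assumes x0: "x0 \<in> X" and s: "range s \<subseteq> X"
    and lim: "filterlim (\<lambda>n. dist x0 (s n)) at_top sequentially"
    and col: "\<And>m n. dist (s m) (s n) \<le> \<bar>dist x0 (s m) - dist x0 (s n)\<bar> + \<delta>"
  shows "amalgamating TYPE('u::metric_space) X (asymptotically_radial X s)"
  unfolding amalgamating_def
proof (intro conjI allI impI ballI)
  show "dist a \<in> asymptotically_radial X s" if "a \<in> X" for a
    unfolding asymptotically_radial_def using that
    by (auto simp: dist_in_Katetov_maps intro!: exI[of _ "{a}"])
  fix u :: 'u and M :: "('u \<times> ('a \<Rightarrow> real)) set"
  assume "finite M \<and> M \<noteq> {} \<and> M \<subseteq> UNIV \<times> asymptotically_radial X s \<and>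
    (\<forall>p\<in>M. \<forall>q\<in>M. compatible X p q)"
  then have M: "finite M" "M \<noteq> {}" "\<And>p. p \<in> M \<Longrightarrow> snd p \<in> Katetov_maps X"
      "\<And>p q. p \<in> M \<Longrightarrow> q \<in> M \<Longrightarrow> compatible X p q"
    and T: "\<And>p. p \<in> M \<Longrightarrow> snd p \<in> asymptotically_radial X s"
    by (auto simp: asymptotically_radial_def)
  have sX: "s n \<in> X" for n using s by auto
  have large: "\<forall>\<^sub>F n in sequentially. C \<le> dist x0 (s n)" for C
    using lim by (simp add: filterlim_at_top)
  let ?m = "maximal_extension u M" and ?h = "minimal_extension u M"
  \<comment> \<open>The distance from \<open>x0\<close> to \<open>s N\<close> absorbs both a bound
    for \<open>t x0\<close> and the defect \<open>\<delta>\<close>.\<close>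
  obtain N where N: "?m x0 + \<delta> \<le> dist x0 (s N)"
    using eventually_happens[OF large[of "?m x0 + \<delta>"]] by auto
  define k where "k = dist (s N)"
  define t where "t x = min (?m x) (max (?h x) (k x))" for x
  have tK: "t \<in> Katetov_maps X"
    unfolding t_def k_def by (rule median_extension_in_Katetov_maps[OF M dist_in_Katetov_maps])
  have tm: "t x \<le> ?m x" for x by (simp add: t_def)
  have "\<exists>F. finite F \<and> F \<subseteq> X \<and> (\<forall>\<^sub>F n in sequentially. \<exists>p\<in>F. t (s n) + t p \<le> dist p (s n) + e)"
    if "0 < e" for e
  proof -
    have "\<forall>p\<in>M. \<exists>F. finite F \<and> F \<subseteq> X \<and>
        (\<forall>\<^sub>F n in sequentially. \<exists>y\<in>F. snd p (s n) + snd p y \<le> dist y (s n) + e)"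
      using T that by (auto simp: asymptotically_radial_def)
    from bchoice[OF this] obtain F where "\<forall>p\<in>M. finite (F p) \<and> F p \<subseteq> X \<and>
        (\<forall>\<^sub>F n in sequentially. \<exists>y\<in>F p. snd p (s n) + snd p y \<le> dist y (s n) + e)" ..
    then have F: "\<And>p. p \<in> M \<Longrightarrow> finite (F p)" "\<And>p. p \<in> M \<Longrightarrow> F p \<subseteq> X"
        "\<And>p. p \<in> M \<Longrightarrow> \<forall>\<^sub>F n in sequentially. \<exists>y\<in>F p. snd p (s n) + snd p y \<le> dist y (s n) + e"
      by simp_all
    let ?F = "insert x0 (\<Union>p\<in>M. F p)"
    have "\<forall>\<^sub>F n in sequentially. \<forall>p\<in>M.
        (\<exists>y\<in>F p. snd p (s n) + snd p y \<le> dist y (s n) + e) \<and> dist u (fst p) + snd p x0 \<le> dist x0 (s n)"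
      by (intro eventually_ball_finite[OF M(1)] ballI eventually_conj F(3) large)
    moreover have "\<forall>\<^sub>F n in sequentially. dist x0 (s N) \<le> dist x0 (s n)"
      by (rule large)
    ultimately have "\<forall>\<^sub>F n in sequentially. \<exists>p\<in>?F. t (s n) + t p \<le> dist p (s n) + e"
    proof eventually_elim
      case (elim n)
      show ?case
      proof (cases "?h (s n) \<le> k (s n)")
        case True
        then have "t (s n) \<le> dist (s N) (s n)" by (simp add: t_def k_def)
        \<comment> \<open>As \<open>s n\<close> is beyond \<open>s N\<close>, \<open>col\<close>
          bounds \<open>dist (s N) (s n)\<close> by
          \<open>dist x0 (s n) - dist x0 (s N) + \<delta>\<close>.\<close>
        then have "t (s n) + t x0 \<le> dist x0 (s n) + e"
          using col[of N n] N tm[of x0] elim(2) that by simp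
        then show ?thesis by blast
      next
        case False
        then have th: "t (s n) \<le> ?h (s n)" by (simp add: t_def)
        obtain p where p: "p \<in> M" "?h (s n) = \<bar>dist u (fst p) - snd p (s n)\<bar>"
          using minimal_extension_attained[OF M(1,2)] .
        \<comment> \<open>At far \<open>s n\<close> the absolute value resolves with the trace as
          the larger term.\<close>
        have "dist x0 (s n) \<le> snd p x0 + snd p (s n)"
          using Katetov_mapsD(2)[OF M(3)[OF p(1)] x0 sX] .
        moreover have "dist u (fst p) + snd p x0 \<le> dist x0 (s n)"
          using elim(1) p(1) by blast
        ultimately have hp: "?h (s n) = snd p (s n) - dist u (fst p)"
          using p(2) by simp
        obtain y where y: "y \<in> F p" "snd p (s n) + snd p y \<le> dist y (s n) + e"
          using elim(1) p(1) by blast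
        have "t (s n) + t y \<le> dist y (s n) + e"
          using th hp y(2) tm[of y] maximal_extension_le[OF M(1) p(1), of u y] by linarith
        then show ?thesis using p(1) y(1) by (intro bexI[of _ y]) auto
      qed
    qed
    moreover have "finite ?F" "?F \<subseteq> X"
      using F(1) M(1) UN_least[of M F X, OF F(2)] x0 by simp_all
    ultimately show ?thesis by (intro exI[of _ ?F] conjI)
  qed
  then have "t \<in> asymptotically_radial X s"
    using tK by (simp add: asymptotically_radial_def)
  moreover have "compatible X p (u, t)" if "p \<in> M" for p
    using M(1) that
    by (rule compatible_between) (use minimal_extension_le_maximal[OF M(1,2,4)] in \<open>auto simp: t_def\<close>)
  ultimately show "\<exists>t\<in>asymptotically_radial X s. \<forall>p\<in>M. compatible X p (u, t)" by blast
qed (auto simp: asymptotically_radial_def)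

section \<open>Noncompact spaces\<close>

text \<open>A complete noncompact set is not totally bounded: for some \<open>e\<close>, the balls
  around finitely many earlier points never cover \<open>X\<close>, so a next point can be chosen
  outside them.\<close>

lemma separated_sequence_if_noncompact:
  fixes X :: "'a::metric_space set"
  assumes "complete X" "\<not> compact X"
  obtains e and s :: "nat \<Rightarrow> 'a" where "0 < e" "range s \<subseteq> X" "\<And>m n. m \<noteq> n \<Longrightarrow> e \<le> dist (s m) (s n)"
proof -
  obtain e where e: "0 < e" "\<And>k. finite k \<Longrightarrow> \<not> X \<subseteq> (\<Union>x\<in>k. ball x e)"
    using assms unfolding compact_eq_totally_bounded by blast
  let ?Q = "\<lambda>x n r. r \<in> X \<and> (\<forall>m<(n::nat). e \<le> dist (x m) r)"
  have "\<exists>s. \<forall>n. ?Q s n (s n)"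
  proof (rule dependent_wellorder_choice)
    show "\<exists>r. ?Q s n r" for n s
      using e(2)[of "s ` {..<n}"] by (auto simp: not_less)
  qed simp
  then obtain s where s: "\<And>n. ?Q s n (s n)" by blast
  have "e \<le> dist (s m) (s n)" if "m \<noteq> n" for m n
    using s[of m] s[of n] that by (cases m n rule: linorder_cases) (auto simp: dist_commute)
  then show ?thesis using that e(1) s by blast
qed

text \<open>Dividing by \<open>e\<close> and rounding down is injective on the indices, so only
  finitely many of the nonnegative values lie below any \<open>C\<close>.\<close>

lemma filterlim_at_top_if_separated:
  fixes r :: "nat \<Rightarrow> real"
  assumes "0 < e" "\<And>n. 0 \<le> r n" and sep: "\<And>m n. m \<noteq> n \<Longrightarrow> e \<le> \<bar>r m - r n\<bar>"
  shows "filterlim r at_top sequentially"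
  unfolding filterlim_at_top
proof
  fix C
  let ?g = "\<lambda>n. \<lfloor>r n / e\<rfloor>"
  have "inj ?g"
  proof (rule injI, rule ccontr)
    fix m n assume eq: "?g m = ?g n" and "m \<noteq> n"
    then have "1 \<le> \<bar>r m - r n\<bar> / e" using sep assms(1) by simp
    also have "\<dots> = \<bar>(r m - r n) / e\<bar>" using assms(1) by simp
    also have "\<dots> = \<bar>r m / e - r n / e\<bar>" by (simp only: diff_divide_distrib)
    finally show False using eq by linarith
  qed
  have "?g ` {n. r n \<le> C} \<subseteq> {0..\<lfloor>C / e\<rfloor>}"
    using assms(1,2) by (auto intro!: floor_mono divide_right_mono)
  then have "finite {n. r n \<le> C}"
    using finite_subset finite_atLeastAtMost_int finite_imageD inj_on_subset[OF \<open>inj ?g\<close> subset_UNIV]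
    by metis
  then have "\<forall>\<^sub>F n in sequentially. n \<notin> {n. r n \<le> C}"
    using cofinite_eq_sequentially eventually_cofinite[of "\<lambda>n. n \<notin> {n. r n \<le> C}"] by simp
  then show "\<forall>\<^sub>F n in sequentially. C \<le> r n"
    by eventually_elim simp
qed

text \<open>Pairs of an \<open>e\<close>-separated sequence are coloured by whether the defect of
  the triangle inequality from \<open>x0\<close> is at least \<open>e / 2\<close>. On a homogeneous
  set where it is smaller, the distances to \<open>x0\<close> differ by at least
  \<open>e / 2\<close> and hence tend to infinity.\<close>

lemma radial_dichotomy:
  fixes X :: "'a::metric_space set"
  assumes "complete X" "\<not> compact X"
  obtains \<delta> and s :: "nat \<Rightarrow> 'a" where "0 < \<delta>" "range s \<subseteq> X"
      "\<And>m n. m \<noteq> n \<Longrightarrow> \<bar>dist x0 (s m) - dist x0 (s n)\<bar> + \<delta> \<le> dist (s m) (s n)"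
  | \<delta> and s :: "nat \<Rightarrow> 'a" where "0 < \<delta>" "range s \<subseteq> X"
      "filterlim (\<lambda>n. dist x0 (s n)) at_top sequentially"
      "\<And>m n. dist (s m) (s n) \<le> \<bar>dist x0 (s m) - dist x0 (s n)\<bar> + \<delta>"
proof -
  obtain e and s :: "nat \<Rightarrow> 'a" where e: "0 < e" and s: "range s \<subseteq> X"
      "\<And>m n. m \<noteq> n \<Longrightarrow> e \<le> dist (s m) (s n)"
    using separated_sequence_if_noncompact[OF assms] by metis
  let ?A = "\<lambda>m n. \<bar>dist x0 (s m) - dist x0 (s n)\<bar> + e / 2 \<le> dist (s m) (s n)"
  define c :: "nat set \<Rightarrow> nat" where "c E = (if \<exists>m n. E = {m, n} \<and> ?A m n then 0 else 1)" for E
  have A_sym: "?A m n \<longleftrightarrow> ?A n m" for m n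
    by (simp add: dist_commute abs_minus_commute)
  have "(\<exists>k l. {m, n} = {k, l} \<and> ?A k l) \<longleftrightarrow> ?A m n" for m n
    unfolding doubleton_eq_iff using A_sym by blast
  then have c: "c {m, n} = (if ?A m n then 0 else 1)" for m n
    by (simp add: c_def)
  obtain Y i where Y: "infinite Y" "\<And>m n. m \<in> Y \<Longrightarrow> n \<in> Y \<Longrightarrow> m \<noteq> n \<Longrightarrow> c {m, n} = i"
  proof -
    have "\<forall>m\<in>UNIV. \<forall>n\<in>UNIV. m \<noteq> n \<longrightarrow> c {m, n} < 2" by (simp add: c)
    from Ramsey2[OF infinite_UNIV_nat this] obtain Y i where
      "infinite Y" "\<forall>m\<in>Y. \<forall>n\<in>Y. m \<noteq> n \<longrightarrow> c {m, n} = i"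
      by (elim exE conjE)
    then show ?thesis using that[of Y i] by simp
  qed
  define r where "r = enumerate Y"
  have r: "r n \<in> Y" "r m = r n \<longleftrightarrow> m = n" for m n
    unfolding r_def
    by (rule enumerate_in_set[OF Y(1)], rule strict_mono_eq[OF strict_mono_enumerate[OF Y(1)]])
  have cr: "c {r m, r n} = i" if "m \<noteq> n" for m n
    by (rule Y(2)) (use r that in auto)
  have rX: "range (s \<circ> r) \<subseteq> X" using s(1) by auto
  show thesis
  proof (cases "i = 0")
    case True
    then have "?A (r m) (r n)" if "m \<noteq> n" for m n
      using cr[OF that] by (simp add: c split: if_splits)
    then show thesis
      using that(1)[of "e / 2" "s \<circ> r"] rX e by simp
  next
    case False
    have A: "dist (s (r m)) (s (r n)) < \<bar>dist x0 (s (r m)) - dist x0 (s (r n))\<bar> + e / 2" if "m \<noteq> n" for m n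
      using cr[OF that] False by (simp add: c split: if_splits)
    have "e / 2 \<le> \<bar>dist x0 (s (r m)) - dist x0 (s (r n))\<bar>" if "m \<noteq> n" for m n
      using A[OF that] s(2)[of "r m" "r n"] r that by simp
    then have "filterlim (\<lambda>n. dist x0 (s (r n))) at_top sequentially"
      using e by (intro filterlim_at_top_if_separated[of "e / 2"]) auto
    moreover have "dist (s (r m)) (s (r n)) \<le> \<bar>dist x0 (s (r m)) - dist x0 (s (r n))\<bar> + e / 2" for m n
      using A[of m n] e by (cases "m = n") auto
    ultimately show thesis
      using that(2)[of "e / 2" "s \<circ> r"] rX e by simp
  qed
qed

text \<open>In a constructed copy the traces of points are only uniformly approximated by the class.
  The condition survives such limits: \<open>t\<close> occurs at two points, with an error of
  \<open>e / 4\<close> each.\<close>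

lemma nearly_finitely_supported_approx:
  assumes t: "\<forall>e>0. \<exists>s\<in>nearly_finitely_supported X. \<forall>x\<in>X. \<bar>t x - s x\<bar> \<le> e" and e: "0 < e"
  shows "\<exists>F. finite F \<and> F \<subseteq> X \<and> (\<forall>x\<in>X. \<exists>p\<in>F. t p + dist p x \<le> t x + e)"
proof -
  have e4: "0 < e / 4" "0 < e / 2" using e by simp_all
  from t[rule_format, OF e4(1)] obtain s where s: "s \<in> nearly_finitely_supported X" "\<forall>x\<in>X. \<bar>t x - s x\<bar> \<le> e / 4" ..
  have "\<forall>e>0. \<exists>F. finite F \<and> F \<subseteq> X \<and> (\<forall>x\<in>X. \<exists>p\<in>F. s p + dist p x \<le> s x + e)"
    using s(1) by (simp add: nearly_finitely_supported_def)
  from this[rule_format, OF e4(2)] obtain F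
    where F: "finite F" "F \<subseteq> X" "\<forall>x\<in>X. \<exists>p\<in>F. s p + dist p x \<le> s x + e / 2"
    by (elim exE conjE)
  have "\<exists>p\<in>F. t p + dist p x \<le> t x + e" if x: "x \<in> X" for x
  proof -
    from F(3)[rule_format, OF x] obtain p where p: "p \<in> F" "s p + dist p x \<le> s x + e / 2" ..
    have "p \<in> X" using F(2) p(1) by blast
    then have "t p + dist p x \<le> t x + e"
      using s(2)[rule_format, OF x] s(2)[rule_format, of p] p(2) by linarith
    then show ?thesis using p(1) by blast
  qed
  then show ?thesis using F(1,2) by blast
qed

lemma asymptotically_radial_approx:
  assumes t: "\<forall>e>0. \<exists>r\<in>asymptotically_radial X s. \<forall>x\<in>X. \<bar>t x - r x\<bar> \<le> e" and e: "0 < e"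
    and s: "range s \<subseteq> X"
  shows "\<exists>F. finite F \<and> F \<subseteq> X \<and> (\<forall>\<^sub>F n in sequentially. \<exists>p\<in>F. t (s n) + t p \<le> dist p (s n) + e)"
proof -
  have e4: "0 < e / 4" "0 < e / 2" using e by simp_all
  from t[rule_format, OF e4(1)] obtain r where r: "r \<in> asymptotically_radial X s" "\<forall>x\<in>X. \<bar>t x - r x\<bar> \<le> e / 4" ..
  have "\<forall>e>0. \<exists>F. finite F \<and> F \<subseteq> X \<and>
      (\<forall>\<^sub>F n in sequentially. \<exists>p\<in>F. r (s n) + r p \<le> dist p (s n) + e)"
    using r(1) by (simp add: asymptotically_radial_def)
  from this[rule_format, OF e4(2)] obtain F where F: "finite F" "F \<subseteq> X"
      "\<forall>\<^sub>F n in sequentially. \<exists>p\<in>F. r (s n) + r p \<le> dist p (s n) + e / 2"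
    by (elim exE conjE)
  have "\<exists>p\<in>F. t (s n) + t p \<le> dist p (s n) + e" if ex: "\<exists>p\<in>F. r (s n) + r p \<le> dist p (s n) + e / 2" for n
  proof -
    obtain p where p: "p \<in> F" "r (s n) + r p \<le> dist p (s n) + e / 2" using ex by blast
    have "s n \<in> X" "p \<in> X" using s F(2) p(1) by auto
    then have "t (s n) + t p \<le> dist p (s n) + e"
      using r(2)[rule_format, of "s n"] r(2)[rule_format, of p] p(2) by linarith
    then show ?thesis using p(1) by blast
  qed
  then have "\<forall>\<^sub>F n in sequentially. \<exists>p\<in>F. t (s n) + t p \<le> dist p (s n) + e"
    by (rule eventually_mono[OF F(3)])
  then show ?thesis using F(1,2) by blast
qed

text \<open>A diagonal argument over a dense sequence makes the differences, which are of Busemann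
  type, converge along the subsequence; density and the Lipschitz bound in \<open>p\<close> carry
  the Cauchy property over to all of \<open>X\<close>.\<close>

lemma radially_convergent_subsequence:
  fixes X :: "'a::metric_space set"
  assumes X: "separable_space (top_of_set X)" and x0: "x0 \<in> X"
  shows "\<exists>k :: nat \<Rightarrow> nat. strict_mono k \<and> (\<forall>p\<in>X. Cauchy (\<lambda>n. dist p (s (k n)) - dist x0 (s (k n))))"
proof -
  obtain a :: "nat \<Rightarrow> 'a" where a: "range a \<subseteq> X" "X \<subseteq> closure (range a)"
    using dense_sequence_separable[OF X] x0 by blast
  \<comment> \<open>The difference is bounded by \<open>dist x0 q\<close> only; the division gives
    the bound 1 uniform in \<open>q\<close> that \<open>function_convergent_subsequence\<close>
    demands.\<close>
  define b where "b n q = (dist q (s n) - dist x0 (s n)) / (1 + dist x0 q)" for n q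
  have pos: "0 < 1 + dist x0 q" for q by (simp add: add_pos_nonneg)
  have b_le: "norm (b n q) \<le> 1" for n q
  proof -
    have "\<bar>dist q (s n) - dist x0 (s n)\<bar> \<le> dist x0 q"
      using dist_triangle[of q "s n" x0] dist_triangle[of x0 "s n" q] by (auto simp: abs_le_iff dist_commute)
    then show ?thesis using pos[of q] by (simp add: b_def)
  qed
  have "countable (range a)" by simp
  then have "\<exists>k :: nat \<Rightarrow> nat. strict_mono k \<and> (\<forall>q\<in>range a. \<exists>l. (\<lambda>n. b (k n) q) \<longlonglongrightarrow> l)"
    by (rule function_convergent_subsequence[of _ b, OF _ b_le]) blast
  then obtain k :: "nat \<Rightarrow> nat" where k: "strict_mono k"
      "\<forall>q\<in>range a. \<exists>l. (\<lambda>n. b (k n) q) \<longlonglongrightarrow> l"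
    by (elim exE conjE)
  have "Cauchy (\<lambda>n. dist p (s (k n)) - dist x0 (s (k n)))" if p: "p \<in> X" for p
  proof (rule metric_CauchyI)
    fix e :: real assume "0 < e"
    then have e4: "0 < e / 4" by simp
    obtain q where q: "q \<in> range a" "dist q p < e / 4"
      using subsetD[OF a(2) p] e4 unfolding closure_approachable by blast
    from k(2)[rule_format, OF q(1)] obtain l where "(\<lambda>n. b (k n) q) \<longlonglongrightarrow> l" ..
    then have "(\<lambda>n. (1 + dist x0 q) * b (k n) q) \<longlonglongrightarrow> (1 + dist x0 q) * l"
      by (intro tendsto_intros)
    then have "Cauchy (\<lambda>n. (1 + dist x0 q) * b (k n) q)" by (rule LIMSEQ_imp_Cauchy)
    moreover have "(1 + dist x0 q) * b n q = dist q (s n) - dist x0 (s n)" for n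
      using pos[of q] by (simp add: b_def)
    ultimately have "Cauchy (\<lambda>n. dist q (s (k n)) - dist x0 (s (k n)))" by simp
    from metric_CauchyD[OF this e4] obtain N where N: "\<forall>m\<ge>N. \<forall>n\<ge>N.
        dist (dist q (s (k m)) - dist x0 (s (k m))) (dist q (s (k n)) - dist x0 (s (k n))) < e / 4" ..
    have pq: "\<bar>dist p y - dist q y\<bar> < e / 4" for y
      using dist_triangle[of p y q] dist_triangle[of q y p] q(2) dist_commute[of p q] by linarith
    have "dist (dist p (s (k m)) - dist x0 (s (k m))) (dist p (s (k n)) - dist x0 (s (k n))) < e"
      if "m \<ge> N" "n \<ge> N" for m n
      using N[rule_format, OF that] pq[of "s (k m)"] pq[of "s (k n)"] unfolding dist_real_def by linarith
    then show "\<exists>N. \<forall>m\<ge>N. \<forall>n\<ge>N.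
        dist (dist p (s (k m)) - dist x0 (s (k m))) (dist p (s (k n)) - dist x0 (s (k n))) < e"
      by blast
  qed
  then show ?thesis using k(1) by blast
qed

text \<open>The infimum below is the largest 1-Lipschitz function bounded by \<open>dist x0\<close>
  at the odd terms; \<open>f\<close> caps it by \<open>dist x0 x + \<delta>\<close>. The defect
  \<open>\<delta>\<close> keeps it from pulling \<open>f\<close> down at the even terms, and
  \<open>dist x0 x \<le> f x\<close> yields the second Katetov inequality.\<close>

lemma oscillating_Katetov_map:
  fixes s :: "nat \<Rightarrow> 'a::metric_space"
  assumes \<delta>: "0 < \<delta>"
    and sep: "\<And>m n. m \<noteq> n \<Longrightarrow> \<bar>dist x0 (s m) - dist x0 (s n)\<bar> + \<delta> \<le> dist (s m) (s n)"
  shows "\<exists>f\<in>Katetov_maps X. (\<forall>n. f (s (2 * n)) = dist x0 (s (2 * n)) + \<delta>) \<and>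
    (\<forall>n. f (s (Suc (2 * n))) = dist x0 (s (Suc (2 * n))))"
proof -
  let ?g = "\<lambda>x n. dist x0 (s (Suc (2 * n))) + dist (s (Suc (2 * n))) x"
  define f where "f x = min (dist x0 x + \<delta>) (INF n. ?g x n)" for x
  have g: "dist x0 x \<le> ?g x n" for x n by (rule dist_triangle)
  have bdd: "bdd_below (range (?g x))" for x
    using g by (intro bdd_belowI2)
  have upper: "(INF n. ?g x n) \<le> ?g x n" for x n
    by (rule cINF_lower[OF bdd]) simp
  have fd: "dist x0 x \<le> f x" for x
    unfolding f_def using \<delta> g by (intro min.boundedI cINF_greatest) auto
  have "f \<in> Katetov_maps X"
  proof (rule Katetov_mapsI)
    fix x y
    have "(INF n. ?g x n) - dist x y \<le> (INF n. ?g y n)"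
    proof (rule cINF_greatest)
      fix n
      show "(INF n. ?g x n) - dist x y \<le> ?g y n"
        using upper[of x n] dist_triangle2[of "s (Suc (2 * n))" x y] by simp
    qed simp
    then show "f x \<le> f y + dist x y"
      using dist_triangle2[of x0 x y] unfolding f_def by linarith
    show "dist x y \<le> f x + f y"
      using fd[of x] fd[of y] dist_triangle3[of x y x0] by simp
  qed
  moreover have "f (s (2 * n)) = dist x0 (s (2 * n)) + \<delta>" for n
  proof -
    have "dist x0 (s (2 * n)) + \<delta> \<le> (INF m. ?g (s (2 * n)) m)"
    proof (rule cINF_greatest)
      fix m
      have "Suc (2 * m) \<noteq> 2 * n" by presburger
      then show "dist x0 (s (2 * n)) + \<delta> \<le> ?g (s (2 * n)) m"
        using sep[of "Suc (2 * m)" "2 * n"] by (simp add: abs_le_iff)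
    qed simp
    then show ?thesis by (simp add: f_def)
  qed
  moreover have "f (s (Suc (2 * n))) = dist x0 (s (Suc (2 * n)))" for n
    using upper[of "s (Suc (2 * n))" n] fd[of "s (Suc (2 * n))"] by (simp add: f_def)
  ultimately show ?thesis by blast
qed

text \<open>Far out, \<open>dist p\<close> and \<open>dist x0\<close> change between consecutive
  terms by the same amount up to \<open>\<delta> / 4\<close>, for all \<open>p\<close> in
  \<open>F\<close>. If \<open>f p + dist p\<close> came within \<open>\<delta> / 4\<close> of
  \<open>f\<close> at an odd term, then at the preceding even term \<open>f\<close> would exceed
  \<open>dist x0\<close> by at most \<open>\<delta> / 2\<close> instead of
  \<open>\<delta>\<close>.\<close>

lemma oscillating_not_nearly_finitely_supported:
  assumes \<delta>: "0 < \<delta>" and s: "range s \<subseteq> X"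
    and f: "f \<in> Katetov_maps X" "\<And>n. f (s (2 * n)) = dist x0 (s (2 * n)) + \<delta>"
      "\<And>n. f (s (Suc (2 * n))) = dist x0 (s (Suc (2 * n)))"
    and conv: "\<forall>p\<in>X. Cauchy (\<lambda>n. dist p (s n) - dist x0 (s n))"
    and F: "finite F" "F \<subseteq> X"
  shows "\<exists>x\<in>X. \<forall>p\<in>F. f x + \<delta> / 4 < f p + dist p x"
proof (rule ccontr)
  assume "\<not> ?thesis"
  then have near: "\<exists>p\<in>F. f p + dist p x \<le> f x + \<delta> / 4" if "x \<in> X" for x
    using that by (auto simp: not_less)
  let ?b = "\<lambda>p n. dist p (s n) - dist x0 (s n)"
  have "\<forall>\<^sub>F n in sequentially. dist (?b p (2 * n)) (?b p (Suc (2 * n))) < \<delta> / 4" if "p \<in> F" for p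
  proof -
    have "p \<in> X" "0 < \<delta> / 4" using that F(2) \<delta> by auto
    from metric_CauchyD[OF bspec[OF conv this(1)] this(2)] obtain N
      where N: "\<forall>m\<ge>N. \<forall>n\<ge>N. dist (?b p m) (?b p n) < \<delta> / 4" by blast
    have "dist (?b p (2 * n)) (?b p (Suc (2 * n))) < \<delta> / 4" if "n \<ge> N" for n
      using N[rule_format, of "2 * n" "Suc (2 * n)"] that by simp
    then show ?thesis unfolding eventually_sequentially by blast
  qed
  then have "\<forall>\<^sub>F n in sequentially. \<forall>p\<in>F. dist (?b p (2 * n)) (?b p (Suc (2 * n))) < \<delta> / 4"
    by (intro eventually_ball_finite[OF F(1)]) blast
  then obtain n where n: "\<And>p. p \<in> F \<Longrightarrow> dist (?b p (2 * n)) (?b p (Suc (2 * n))) < \<delta> / 4"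
    using eventually_happens'[OF sequentially_bot] by blast
  have sX: "s m \<in> X" for m using s by auto
  obtain p where p: "p \<in> F" "f p + dist p (s (Suc (2 * n))) \<le> f (s (Suc (2 * n))) + \<delta> / 4"
    using near[OF sX] by blast
  have "f (s (2 * n)) \<le> f p + dist p (s (2 * n))"
    using Katetov_mapsD(1)[OF f(1) sX, of p "2 * n"] p(1) F(2) by (auto simp: dist_commute)
  then show False
    using n[OF p(1)] p(2) \<delta> unfolding f(2,3) dist_real_def by linarith
qed

text \<open>An isometry that carries another copy of \<open>X\<close> onto this one may permute the
  points of \<open>X\<close>; excluding every \<open>f \<circ> \<sigma>\<close> accounts for
  this.\<close>

lemma noncompact_unrealized_Katetov_map:
  fixes X :: "'a::metric_space set"
  assumes U: "finitely_injective (UNIV :: 'u::polish_space set)"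
    and X: "complete X" "separable_space (top_of_set X)" "\<not> compact X"
  shows "\<exists>f (j :: 'a \<Rightarrow> 'u::polish_space). f \<in> Katetov_maps X \<and> isometry j X (j ` X) \<and>
    (\<forall>\<sigma> z. isometry \<sigma> X X \<longrightarrow> (\<exists>x\<in>X. dist z (j x) \<noteq> f (\<sigma> x)))"
proof -
  have "X \<noteq> {}" using X(3) by auto
  then obtain x0 where x0: "x0 \<in> X" by blast
  from X(1,3) show ?thesis
  proof (cases rule: radial_dichotomy[where ?x0.0 = x0])
    case (1 \<delta> s0)
    from radially_convergent_subsequence[OF X(2) x0, of s0] obtain k :: "nat \<Rightarrow> nat" where k: "strict_mono k"
        "\<forall>p\<in>X. Cauchy (\<lambda>n. dist p (s0 (k n)) - dist x0 (s0 (k n)))"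
      by (elim exE conjE)
    define s where "s n = s0 (k n)" for n
    have s: "range s \<subseteq> X" using 1(2) by (auto simp: s_def)
    have sep: "\<bar>dist x0 (s m) - dist x0 (s n)\<bar> + \<delta> \<le> dist (s m) (s n)" if "m \<noteq> n" for m n
      using 1(3)[of "k m" "k n"] strict_mono_eq[OF k(1)] that by (simp add: s_def)
    have "\<exists>f\<in>Katetov_maps X. (\<forall>n. f (s (2 * n)) = dist x0 (s (2 * n)) + \<delta>) \<and>
        (\<forall>n. f (s (Suc (2 * n))) = dist x0 (s (Suc (2 * n))))"
      by (rule oscillating_Katetov_map[OF 1(1) sep])
    then obtain f where f: "f \<in> Katetov_maps X"
        "\<forall>n. f (s (2 * n)) = dist x0 (s (2 * n)) + \<delta>" "\<forall>n. f (s (Suc (2 * n))) = dist x0 (s (Suc (2 * n)))"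
      by (elim bexE conjE)
    note amal = amalgamating_nearly_finitely_supported
    from embedding_with_prescribed_traces[OF U X(2) \<open>X \<noteq> {}\<close> amal amalgamating_dist[OF amal[where ?'u = 'u] x0]]
    obtain j :: "'a \<Rightarrow> 'u" where j: "isometry j X (j ` X)"
        "\<forall>z. \<forall>e>0. \<exists>t\<in>nearly_finitely_supported X. \<forall>x\<in>X. \<bar>dist z (j x) - t x\<bar> \<le> e"
      by (elim exE conjE)
    have "\<exists>x\<in>X. dist z (j x) \<noteq> f (\<sigma> x)" if \<sigma>: "isometry \<sigma> X X" for \<sigma> z
    proof (rule ccontr)
      assume "\<not> (\<exists>x\<in>X. dist z (j x) \<noteq> f (\<sigma> x))"
      then have zf: "dist z (j x) = f (\<sigma> x)" if "x \<in> X" for x using that by blast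
      have "0 < \<delta> / 4" using 1(1) by simp
      from nearly_finitely_supported_approx[OF spec[OF j(2)] this, of z]
      obtain F where F: "finite F" "F \<subseteq> X"
          "\<forall>x\<in>X. \<exists>p\<in>F. dist z (j p) + dist p x \<le> dist z (j x) + \<delta> / 4"
        by (elim exE conjE)
      \<comment> \<open>\<open>\<sigma>\<close> carries the finite support of the trace of
        \<open>z\<close> to one for \<open>f\<close>.\<close>
      have "finite (\<sigma> ` F)" "\<sigma> ` F \<subseteq> X" using F(1,2) \<sigma> by (auto simp: isometry_def)
      from oscillating_not_nearly_finitely_supported
          [OF 1(1) s f(1) f(2,3)[rule_format] k(2)[folded s_def] this]
      obtain y where y: "y \<in> X" "\<forall>p\<in>\<sigma> ` F. f y + \<delta> / 4 < f p + dist p y"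
        by (elim bexE)
      have "y \<in> \<sigma> ` X" using y(1) \<sigma> by (simp add: isometry_def)
      then obtain x where x: "x \<in> X" "y = \<sigma> x" by blast
      obtain p where p: "p \<in> F" "dist z (j p) + dist p x \<le> dist z (j x) + \<delta> / 4"
        using F(3) x(1) by blast
      have "p \<in> X" using p(1) F(2) by blast
      moreover have "dist (\<sigma> p) y = dist p x"
        using \<sigma> x \<open>p \<in> X\<close> by (auto simp: isometry_def)
      moreover have "f y + \<delta> / 4 < f (\<sigma> p) + dist (\<sigma> p) y" using y(2) p(1) by blast
      ultimately show False using p(2) zf[of p] zf[OF x(1)] x(2) by simp
    qed
    then show ?thesis using f(1) j(1) by (intro exI[of _ f] exI[of _ j]) simp
  next
    case (2 \<delta> s)
    note amal = amalgamating_asymptotically_radial[OF x0 2(2,3,4)]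
    define f where "f x = dist x0 x + 1" for x
    have fK: "f \<in> Katetov_maps X"
    proof (rule Katetov_mapsI)
      fix x y
      show "f x \<le> f y + dist x y" using dist_triangle2[of x0 x y] by (simp add: f_def)
      show "dist x y \<le> f x + f y" using dist_triangle3[of x y x0] by (simp add: f_def)
    qed
    from embedding_with_prescribed_traces[OF U X(2) \<open>X \<noteq> {}\<close> amal amalgamating_dist[OF amal[where ?'u = 'u] x0]]
    obtain j :: "'a \<Rightarrow> 'u" where j: "isometry j X (j ` X)"
        "\<forall>z. \<forall>e>0. \<exists>t\<in>asymptotically_radial X s. \<forall>x\<in>X. \<bar>dist z (j x) - t x\<bar> \<le> e"
      by (elim exE conjE)
    have "\<exists>x\<in>X. dist z (j x) \<noteq> f (\<sigma> x)" if \<sigma>: "isometry \<sigma> X X" for \<sigma> z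
    proof (rule ccontr)
      assume "\<not> (\<exists>x\<in>X. dist z (j x) \<noteq> f (\<sigma> x))"
      then have zf: "dist z (j x) = f (\<sigma> x)" if "x \<in> X" for x using that by blast
      have "x0 \<in> \<sigma> ` X" using x0 \<sigma> by (simp add: isometry_def)
      then obtain x1 where x1: "x1 \<in> X" "x0 = \<sigma> x1" by blast
      have zd: "dist z (j x) = dist x1 x + 1" if "x \<in> X" for x
        using zf[OF that] \<sigma> x1 that by (simp add: f_def isometry_def)
      \<comment> \<open>Tolerance 1 gives a contradiction: the triangle inequality through
        \<open>x1\<close> makes \<open>dist z (j (s n)) + dist z (j p)\<close> at least
        \<open>dist p (s n) + 2\<close>.\<close>
      from asymptotically_radial_approx[OF spec[OF j(2)] zero_less_one 2(2), of z]
      obtain F where F: "F \<subseteq> X"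
          "\<forall>\<^sub>F n in sequentially. \<exists>p\<in>F. dist z (j (s n)) + dist z (j p) \<le> dist p (s n) + 1"
        by (elim exE conjE)
      then obtain n p where p: "p \<in> F" "dist z (j (s n)) + dist z (j p) \<le> dist p (s n) + 1"
        using eventually_happens'[OF sequentially_bot F(2)] by blast
      have "s n \<in> X" "p \<in> X" using 2(2) F(1) p(1) by auto
      then show False
        using p(2) dist_triangle3[of p "s n" x1] by (simp add: zd)
    qed
    then show ?thesis using fK j(1) by (intro exI[of _ f] exI[of _ j]) simp
  qed
qed

section \<open>The equivalences\<close>

theorem theorem4p1:
  fixes X :: "'a::metric_space set"
  assumes "is_Urysohn TYPE('u::polish_space)"
    and "Polish_metric X"
  shows "(compact X \<longleftrightarrow>
            (\<forall>(X1 :: 'u set) (X2 :: 'u set) \<phi>.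
               isometric X1 X \<and> isometric X2 X \<and> isometry \<phi> X1 X2 \<longrightarrow>
               (\<exists>\<psi>\<in>Iso (UNIV :: 'u set). \<forall>x\<in>X1. \<psi> x = \<phi> x))) \<and>
         (compact X \<longleftrightarrow>
            (\<forall>(X1 :: 'u set) (X2 :: 'u set).
               isometric X1 X \<and> isometric X2 X \<longrightarrow>
               (\<exists>\<phi>\<in>Iso (UNIV :: 'u set). \<phi> ` X1 = X2))) \<and>
         (compact X \<longleftrightarrow>
            (\<forall>(X1 :: 'u set) f.
               isometric X1 X \<and> f \<in> Katetov_maps X1 \<longrightarrow>
               (\<exists>z :: 'u. \<forall>x\<in>X1. dist z x = f x)))"
    (is "(_ \<longleftrightarrow> ?b) \<and> (_ \<longleftrightarrow> ?c) \<and> (_ \<longleftrightarrow> ?d)")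
proof -
  have U: "finitely_injective (UNIV :: 'u set)"
    using assms(1) by (simp add: is_Urysohn_def)
  have X: "complete X" "separable_space (top_of_set X)"
    using assms(2) by (auto simp: Polish_metric_def)
  have compact_copy: "compact X1" if "compact X" "isometric X1 X" for X1 :: "'u set"
    using that isometry_sym isometry_imp_compact unfolding isometric_def by blast
  have ab: ?b if "compact X"
    using compact_homogeneity[OF U compact_copy[OF that]] by blast
  have ad: ?d if "compact X"
    using realize_compact_Katetov_map[OF U compact_copy[OF that]] by blast
  have bc: ?c if b: ?b
  proof (intro allI impI, elim conjE)
    fix X1 X2 :: "'u set" assume iso: "isometric X1 X" "isometric X2 X"
    then obtain g h where "isometry g X1 X" "isometry h X2 X"
      by (auto simp: isometric_def)
    then have \<phi>: "isometry (inv_into X2 h \<circ> g) X1 X2"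
      using isometry_sym isometry_trans by blast
    then obtain \<psi> where \<psi>: "\<psi> \<in> Iso UNIV" "\<forall>x\<in>X1. \<psi> x = (inv_into X2 h \<circ> g) x"
      using b iso by blast
    have "\<psi> ` X1 = (inv_into X2 h \<circ> g) ` X1" using \<psi>(2) by (intro image_cong) auto
    then show "\<exists>\<phi>\<in>Iso UNIV. \<phi> ` X1 = X2" using \<psi>(1) \<phi> by (auto simp: isometry_def)
  qed
  \<comment> \<open>Failure of compactness refutes (c) and (d), and through \<open>bc\<close> also
    (b).\<close>
  have nc: "\<not> ?c" "\<not> ?d" if nc: "\<not> compact X"
  proof -
    from noncompact_unrealized_Katetov_map[OF U X nc]
    obtain f and j :: "'a \<Rightarrow> 'u" where f: "f \<in> Katetov_maps X" and j: "isometry j X (j ` X)"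
      and "\<forall>\<sigma> z. isometry \<sigma> X X \<longrightarrow> (\<exists>x\<in>X. dist z (j x) \<noteq> f (\<sigma> x))"
      by (elim exE conjE)
    then have unrealized: "\<not> (\<forall>x\<in>X. dist z (j x) = f (\<sigma> x))" if "isometry \<sigma> X X" for \<sigma> z
      using that by simp
    have jX: "isometric (j ` X) X" using isometry_sym[OF j] by (auto simp: isometric_def)
    have "X \<noteq> {}" using nc by auto
    show "\<not> ?d"
    proof
      assume d: ?d
      \<comment> \<open>\<open>f\<close> is transported to the copy by the inverse of
        \<open>j\<close>; the self-isometry of \<open>X\<close> involved is the identity.\<close>
      define g where "g = inv_into X j"
      have g: "isometry g (j ` X) X" unfolding g_def by (rule isometry_sym[OF j])
      have gj: "g (j x) = x" if "x \<in> X" for x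
        using isometry_inj_on[OF j] that by (simp add: g_def)
      have "f \<circ> g \<in> Katetov_maps (j ` X)"
      proof (rule Katetov_mapsI)
        fix x y assume "x \<in> j ` X" "y \<in> j ` X"
        then have "g x \<in> X" "g y \<in> X" "dist (g x) (g y) = dist x y"
          using g by (auto simp: isometry_def)
        then show "(f \<circ> g) x \<le> (f \<circ> g) y + dist x y" "dist x y \<le> (f \<circ> g) x + (f \<circ> g) y"
          using Katetov_mapsD(1,2)[OF f, of "g x" "g y"] by simp_all
      qed
      then obtain z where "\<forall>x\<in>j ` X. dist z x = (f \<circ> g) x" using d jX by blast
      then have "\<forall>x\<in>X. dist z (j x) = f (id x)" by (simp add: gj)
      moreover have "isometry id X X" by (simp add: isometry_def)
      ultimately show False using unrealized by blast
    qed
    show "\<not> ?c"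
    proof
      assume c: ?c
      \<comment> \<open>Over the copy given by \<open>i\<close> the map \<open>f\<close> is
        realized. An isometry taking it to the copy given by \<open>j\<close> moves the realizing
        point to one that realizes \<open>f \<circ> \<sigma>\<close>, where \<open>\<sigma>\<close>
        compares the two parametrizations of the latter copy.\<close>
      from embedding_with_prescribed_traces[OF U X(2) \<open>X \<noteq> {}\<close> amalgamating_Katetov_maps f]
      obtain i :: "'a \<Rightarrow> 'u" and z where i: "isometry i X (i ` X)" and z: "\<forall>x\<in>X. dist z (i x) = f x"
        by (elim exE conjE)
      have "isometric (i ` X) X" using isometry_sym[OF i] by (auto simp: isometric_def)
      then obtain \<phi> where \<phi>: "\<phi> \<in> Iso UNIV" "\<phi> ` i ` X = j ` X" using c jX by meson
      have \<phi>d: "dist (\<phi> x) (\<phi> y) = dist x y" for x y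
        using \<phi>(1) by (simp add: Iso_def isometry_def)
      then have "isometry \<phi> (i ` X) (j ` X)" using \<phi>(2) by (simp add: isometry_def)
      then have \<phi>i: "isometry (\<phi> \<circ> i) X (j ` X)" using isometry_trans[OF i] by blast
      define \<sigma> where "\<sigma> = inv_into X (\<phi> \<circ> i) \<circ> j"
      have \<sigma>: "isometry \<sigma> X X"
        unfolding \<sigma>_def by (rule isometry_trans[OF j isometry_sym[OF \<phi>i]])
      have "dist (\<phi> z) (j x) = f (\<sigma> x)" if x: "x \<in> X" for x
      proof -
        have "j x \<in> (\<phi> \<circ> i) ` X" using x \<phi>i by (auto simp: isometry_def)
        then have "\<sigma> x \<in> X" "\<phi> (i (\<sigma> x)) = j x"
          using inv_into_into[of "j x" "\<phi> \<circ> i" X] f_inv_into_f[of "j x" "\<phi> \<circ> i" X] by (auto simp: \<sigma>_def)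
        then show ?thesis using \<phi>d[of z "i (\<sigma> x)"] z by simp
      qed
      then show False using unrealized[OF \<sigma>] by blast
    qed
  qed
  show ?thesis
    using ab ad bc nc by satx
qed

end
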